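(* Let $m\ge 1$ be an integer, let $0<x_m\le\cdots\le x_1\le u<v<w$, and let $\widetilde\alpha^{(m)}=\widetilde\alpha^{(m)}(u,v,w):\sqrt{x_m},\ldots,\sqrt{x_1},(\sqrt u,\sqrt v,\sqrt w)^\wedge$ be the corresponding backward $m$-step extension. Put $m_0=\left[\frac m2\right]+1$ and assume $v_k>0$ for all $k\ge 0$. Then the weighted shift $W_{\widetilde\alpha^{(m)}}$ is semi-cubically hyponormal with p.d.c. if and only if the following conditions hold for each $j=1,2$: (i) for each $i$ with $0\le i\le m_0-1$, at least one of the following holds: (a) $\sum_{k=0}^{i}Q_k^{[j]}\,\widehat c^{[j]}(m_0,m_0-k)\ge 0$ and $c^{[j]}(m_0+1+i,m_0+1)\ge 0$, or (b) $\sum_{k=0}^{i}Q_k^{[j]}\,\widehat c^{[j]}(m_0,m_0-k)\le 0$ and $v^{[j]}_{m_0}\cdots v^{[j]}_0+\sum_{k=0}^{i}K^{k+1}\,\widehat c^{[j]}(m_0,m_0-k)\ge 0$; (ii) for each $n$ with $1\le n\le m_0$ and each $i$ with $1\le i\le n$, $c^{[j]}(n,i)\ge 0$; (iii) for each $n$ with $m_0+1\le n\le 2m_0-1$ and each $i$ with $n+1-m_0\le i\le m_0$, $c^{[j]}(n,i)\ge 0$.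
   Context: Stampfli completion: for $0<u<v<w$ let $\Psi_0=-\frac{uv(w-v)}{v-u}$ and $\Psi_1=\frac{v(w-u)}{v-u}$; $(\sqrt u,\sqrt v,\sqrt w)^\wedge$ is the positive sequence $\{\beta_n\}_{n\ge0}$ with $\beta_0^2=u$, $\beta_1^2=v$, $\beta_2^2=w$ and $\beta_n^2=\Psi_1+\Psi_0/\beta_{n-1}^2$ for $n\ge 3$. The backward $m$-step extension $\widetilde\alpha^{(m)}(u,v,w)=\{\alpha_n\}_{n\ge0}$ is the sequence $\sqrt{x_m},\ldots,\sqrt{x_1},\beta_0,\beta_1,\beta_2,\ldots$ (so $\alpha_m=\sqrt u$). Let $L=\frac1{\sqrt2}\left(\Psi_1+\sqrt{\Psi_1^2+4\Psi_0}\right)^{1/2}$ and $K=\frac{(\Psi_1^2+\Psi_0)^2}{\Psi_0^2}L^4$. $W_\alpha$ is the weighted shift on $\ell^2(\mathbb N_0)$, $W_\alpha e_k=\alpha_k e_{k+1}$. It is semi-cubically hyponormal if $W_\alpha+sW_\alpha^3$ is hyponormal for all $s\in\mathbb C$ (an operator $T$ is hyponormal if $T^*T-TT^*\ge 0$). With $\alpha_{-3}=\alpha_{-2}=\alpha_{-1}=0$ put, for $k\ge 0$: $u_k=\alpha_k^2-\alpha_{k-1}^2$, $v_k=\alpha_k^2\alpha_{k+1}^2\alpha_{k+2}^2-\alpha_{k-3}^2\alpha_{k-2}^2\alpha_{k-1}^2$, $w_k=\alpha_k^2\alpha_{k+1}^2(\alpha_{k+2}^2-\alpha_{k-1}^2)^2$.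 For $j=1$ set $(u^{[1]}_n,v^{[1]}_n,w^{[1]}_n)=(u_{2n},v_{2n},w_{2n})$, and for $j=2$ set $(u^{[2]}_n,v^{[2]}_n,w^{[2]}_n)=(u_{2n+1},v_{2n+1},w_{2n+1})$, $n\ge0$. For $t\ge0$, $D_n^{[j]}(t)$ is the $(n+1)\times(n+1)$ symmetric tridiagonal matrix with diagonal entries $u^{[j]}_k+v^{[j]}_kt$ ($0\le k\le n$) and off-diagonal entries $\sqrt{w^{[j]}_kt}$ in positions $(k,k+1)$ and $(k+1,k)$ ($0\le k\le n-1$). Write $\det D_n^{[j]}(t)=\sum_{i=0}^{n+1}c^{[j]}(n,i)t^i$, with $c^{[j]}(n,i)=0$ for $i>n+1$, and for $n\ge1$ put $\widehat c^{[j]}(n,i)=c^{[j]}(n,i)-u^{[j]}_n c^{[j]}(n-1,i)$. The family $D_n^{[j]}$ has positive determinant coefficients (p.d.c.) if $c^{[j]}(n,i)\ge0$ for all $n\ge 0$, $0\le i\le n+1$, and $c^{[j]}(n,n+1)>0$ for all $n$. $W_\alpha$ is semi-cubically hyponormal with p.d.c. if it is semi-cubically hyponormal and both families $D_n^{[1]}$, $D_n^{[2]}$ have positive determinant coefficients. Let $\eta_n=v_n/u_n$, $\eta^{[1]}_n=\eta_{2n}$, $\eta^{[2]}_n=\eta_{2n+1}$ (for $n\ge m_0+1$), and for $k\ge0$, $\ell\ge m_0+1$ let $Q^{[j]}(\ell,k)=\dfrac{\prod_{r=1}^{k+1}\eta^{[j]}_{\ell+r}-\prod_{r=0}^{k}\eta^{[j]}_{\ell+r}}{\eta^{[j]}_{\ell+1}-\eta^{[j]}_{\ell}}$.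 This value does not depend on $\ell\ge m_0+1$; it is denoted $Q^{[j]}_k$ (e.g. take $\ell=m_0+1$). $[x]$ denotes the integer part of $x$. *)

theory Defs
  imports Complex_Main "Jordan_Normal_Form.Determinant"
begin

section \<open>Bounded operators on the complex sequence space $\ell^2$ and hyponormality\<close>

text \<open>
  An operator on $\ell^2$ is a function on complex sequences of which only the restriction to the
  set \<open>ell2\<close> matters.
\<close>

definition ell2 :: "(nat \<Rightarrow> complex) set" where
  "ell2 = {x. summable (\<lambda>n. (cmod (x n))\<^sup>2)}"

definition ell2_inner :: "(nat \<Rightarrow> complex) \<Rightarrow> (nat \<Rightarrow> complex) \<Rightarrow> complex" where
  "ell2_inner x y = (\<Sum>n. x n * cnj (y n))"

definition ell2_norm :: "(nat \<Rightarrow> complex) \<Rightarrow> real" where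
  "ell2_norm x = sqrt (\<Sum>n. (cmod (x n))\<^sup>2)"

definition bounded_operator :: "((nat \<Rightarrow> complex) \<Rightarrow> (nat \<Rightarrow> complex)) \<Rightarrow> bool" where
  "bounded_operator T \<longleftrightarrow>
     (\<forall>x\<in>ell2. T x \<in> ell2) \<and>
     (\<forall>x\<in>ell2. \<forall>y\<in>ell2. T (\<lambda>n. x n + y n) = (\<lambda>n. T x n + T y n)) \<and>
     (\<forall>a. \<forall>x\<in>ell2. T (\<lambda>n. a * x n) = (\<lambda>n. a * T x n)) \<and>
     (\<exists>C. \<forall>x\<in>ell2. ell2_norm (T x) \<le> C * ell2_norm x)"

text \<open>
  On \<open>ell2\<close> the adjoint is uniquely determined by these conditions; the choice operator is
  only free outside \<open>ell2\<close>.
\<close>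

definition operator_adjoint ::
  "((nat \<Rightarrow> complex) \<Rightarrow> (nat \<Rightarrow> complex)) \<Rightarrow> (nat \<Rightarrow> complex) \<Rightarrow> (nat \<Rightarrow> complex)" where
  "operator_adjoint T = (SOME S. bounded_operator S \<and>
     (\<forall>x\<in>ell2. \<forall>y\<in>ell2. ell2_inner (T x) y = ell2_inner x (S y)))"

definition positive_operator :: "((nat \<Rightarrow> complex) \<Rightarrow> (nat \<Rightarrow> complex)) \<Rightarrow> bool" where
  "positive_operator A \<longleftrightarrow>
     (\<forall>x\<in>ell2. ell2_inner (A x) x \<in> \<real> \<and> 0 \<le> Re (ell2_inner (A x) x))"

definition hyponormal :: "((nat \<Rightarrow> complex) \<Rightarrow> (nat \<Rightarrow> complex)) \<Rightarrow> bool" where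
  "hyponormal T \<longleftrightarrow> bounded_operator T \<and>
     positive_operator (\<lambda>x n. operator_adjoint T (T x) n - T (operator_adjoint T x) n)"

definition weighted_shift :: "(nat \<Rightarrow> real) \<Rightarrow> (nat \<Rightarrow> complex) \<Rightarrow> (nat \<Rightarrow> complex)" where
  "weighted_shift \<alpha> x n = (case n of 0 \<Rightarrow> 0 | Suc k \<Rightarrow> complex_of_real (\<alpha> k) * x k)"

definition semi_cubically_hyponormal ::
  "((nat \<Rightarrow> complex) \<Rightarrow> (nat \<Rightarrow> complex)) \<Rightarrow> bool" where
  "semi_cubically_hyponormal T \<longleftrightarrow>
     (\<forall>s::complex. hyponormal (\<lambda>x n. T x n + s * (T ^^ 3) x n))"


section \<open>Stampfli completion and its backward extensions\<close>

definition Psi0 :: "real \<Rightarrow> real \<Rightarrow> real \<Rightarrow> real" where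
  "Psi0 u v w = - (u * v * (w - v) / (v - u))"

definition Psi1 :: "real \<Rightarrow> real \<Rightarrow> real \<Rightarrow> real" where
  "Psi1 u v w = v * (w - u) / (v - u)"

fun stampfli :: "real \<Rightarrow> real \<Rightarrow> real \<Rightarrow> nat \<Rightarrow> real" where
  "stampfli u v w 0 = sqrt u"
| "stampfli u v w (Suc 0) = sqrt v"
| "stampfli u v w (Suc (Suc 0)) = sqrt w"
| "stampfli u v w (Suc (Suc (Suc n))) =
     sqrt (Psi1 u v w + Psi0 u v w / (stampfli u v w (Suc (Suc n)))\<^sup>2)"

text \<open>The weights prepended to the completion are $\sqrt{x_m},\dots,\sqrt{x_1}$, in this order.\<close>

definition backward_extension ::
  "nat \<Rightarrow> (nat \<Rightarrow> real) \<Rightarrow> real \<Rightarrow> real \<Rightarrow> real \<Rightarrow> nat \<Rightarrow> real" where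
  "backward_extension m x u v w n =
     (if n < m then sqrt (x (m - n)) else stampfli u v w (n - m))"

definition stampfli_L :: "real \<Rightarrow> real \<Rightarrow> real \<Rightarrow> real" where
  "stampfli_L u v w = 1 / sqrt 2 * sqrt (Psi1 u v w + sqrt ((Psi1 u v w)\<^sup>2 + 4 * Psi0 u v w))"

definition stampfli_K :: "real \<Rightarrow> real \<Rightarrow> real \<Rightarrow> real" where
  "stampfli_K u v w =
     ((Psi1 u v w)\<^sup>2 + Psi0 u v w)\<^sup>2 / (Psi0 u v w)\<^sup>2 * stampfli_L u v w ^ 4"


section \<open>The tridiagonal matrices and their determinant coefficients\<close>

definition zero_ext :: "(nat \<Rightarrow> real) \<Rightarrow> int \<Rightarrow> real" where
  "zero_ext \<alpha> k = (if k < 0 then 0 else \<alpha> (nat k))"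

definition u_seq :: "(nat \<Rightarrow> real) \<Rightarrow> nat \<Rightarrow> real" where
  "u_seq \<alpha> k = (let a = zero_ext \<alpha>; k = int k in (a k)\<^sup>2 - (a (k - 1))\<^sup>2)"

definition v_seq :: "(nat \<Rightarrow> real) \<Rightarrow> nat \<Rightarrow> real" where
  "v_seq \<alpha> k = (let a = zero_ext \<alpha>; k = int k in
     (a k)\<^sup>2 * (a (k + 1))\<^sup>2 * (a (k + 2))\<^sup>2 - (a (k - 3))\<^sup>2 * (a (k - 2))\<^sup>2 * (a (k - 1))\<^sup>2)"

definition w_seq :: "(nat \<Rightarrow> real) \<Rightarrow> nat \<Rightarrow> real" where
  "w_seq \<alpha> k = (let a = zero_ext \<alpha>; k = int k in
     (a k)\<^sup>2 * (a (k + 1))\<^sup>2 * ((a (k + 2))\<^sup>2 - (a (k - 1))\<^sup>2)\<^sup>2)"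

text \<open>
  The family index \<open>j\<close> only ever takes the values 1 (even-indexed terms) and 2 (odd-indexed terms).
\<close>

definition branch :: "(nat \<Rightarrow> real) \<Rightarrow> nat \<Rightarrow> nat \<Rightarrow> real" where
  "branch a j n = (if j = 1 then a (2 * n) else a (2 * n + 1))"

abbreviation u_br :: "(nat \<Rightarrow> real) \<Rightarrow> nat \<Rightarrow> nat \<Rightarrow> real" where
  "u_br \<alpha> \<equiv> branch (u_seq \<alpha>)"

abbreviation v_br :: "(nat \<Rightarrow> real) \<Rightarrow> nat \<Rightarrow> nat \<Rightarrow> real" where
  "v_br \<alpha> \<equiv> branch (v_seq \<alpha>)"

abbreviation w_br :: "(nat \<Rightarrow> real) \<Rightarrow> nat \<Rightarrow> nat \<Rightarrow> real" where
  "w_br \<alpha> \<equiv> branch (w_seq \<alpha>)"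

definition D_mat :: "(nat \<Rightarrow> real) \<Rightarrow> nat \<Rightarrow> nat \<Rightarrow> real \<Rightarrow> real mat" where
  "D_mat \<alpha> j n t = mat (n + 1) (n + 1) (\<lambda>(r, s).
     if r = s then u_br \<alpha> j r + v_br \<alpha> j r * t
     else if s = r + 1 then sqrt (w_br \<alpha> j r * t)
     else if r = s + 1 then sqrt (w_br \<alpha> j s * t)
     else 0)"

text \<open>
  For \<open>t \<ge> 0\<close> the square roots cancel in the determinant, which is a polynomial in \<open>t\<close> of degree
  at most \<open>n + 1\<close>; that polynomial is unique because it is prescribed at infinitely many points.
\<close>

definition det_poly :: "(nat \<Rightarrow> real) \<Rightarrow> nat \<Rightarrow> nat \<Rightarrow> real poly" where
  "det_poly \<alpha> j n = (THE p. degree p \<le> n + 1 \<and> (\<forall>t\<ge>0. det (D_mat \<alpha> j n t) = poly p t))"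

definition c_coeff :: "(nat \<Rightarrow> real) \<Rightarrow> nat \<Rightarrow> nat \<Rightarrow> nat \<Rightarrow> real" where
  "c_coeff \<alpha> j n i = coeff (det_poly \<alpha> j n) i"

text \<open>Only used for \<open>n \<ge> 1\<close>.\<close>

definition c_hat :: "(nat \<Rightarrow> real) \<Rightarrow> nat \<Rightarrow> nat \<Rightarrow> nat \<Rightarrow> real" where
  "c_hat \<alpha> j n i = c_coeff \<alpha> j n i - u_br \<alpha> j n * c_coeff \<alpha> j (n - 1) i"

definition pos_det_coeffs :: "(nat \<Rightarrow> real) \<Rightarrow> nat \<Rightarrow> bool" where
  "pos_det_coeffs \<alpha> j \<longleftrightarrow>
     (\<forall>n. \<forall>i\<le>n + 1. 0 \<le> c_coeff \<alpha> j n i) \<and> (\<forall>n. 0 < c_coeff \<alpha> j n (n + 1))"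

definition semi_cubically_hyponormal_pdc :: "(nat \<Rightarrow> real) \<Rightarrow> bool" where
  "semi_cubically_hyponormal_pdc \<alpha> \<longleftrightarrow>
     semi_cubically_hyponormal (weighted_shift \<alpha>) \<and> pos_det_coeffs \<alpha> 1 \<and> pos_det_coeffs \<alpha> 2"

definition eta_br :: "(nat \<Rightarrow> real) \<Rightarrow> nat \<Rightarrow> nat \<Rightarrow> real" where
  "eta_br \<alpha> = branch (\<lambda>n. v_seq \<alpha> n / u_seq \<alpha> n)"

definition Q_quot :: "(nat \<Rightarrow> real) \<Rightarrow> nat \<Rightarrow> nat \<Rightarrow> nat \<Rightarrow> real" where
  "Q_quot \<alpha> j l k =
     ((\<Prod>r=1..k+1. eta_br \<alpha> j (l + r)) - (\<Prod>r=0..k. eta_br \<alpha> j (l + r))) /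
     (eta_br \<alpha> j (l + 1) - eta_br \<alpha> j l)"

text \<open>
  For a backward \<open>m\<close>-step extension and \<open>m0 = m div 2 + 1\<close>, \<open>Q_quot \<alpha> j l k\<close> is the same for all
  \<open>l \<ge> m0 + 1\<close>; the representative \<open>l = m0 + 1\<close> is used.
\<close>

definition Q_coeff :: "(nat \<Rightarrow> real) \<Rightarrow> nat \<Rightarrow> nat \<Rightarrow> nat \<Rightarrow> real" where
  "Q_coeff \<alpha> m0 j k = Q_quot \<alpha> j (m0 + 1) k"

end

(*
  On even and on odd indices the self-commutator of W + s W^3 acts as a tridiagonal matrix with
  leading minors det D_n(|s|^2).  If all determinant coefficients are nonnegative
  and the leading ones positive, these minors are positive for s \<noteq> 0, and completing squares gives
  hyponormality; so everything reduces to the signs of the coefficients c(n,i).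

  From index m0 on the Stampfli recursion gives w_n = u_n v_{n+1}, which turns the three-term
  recursion of the determinants into chat(n+1,i+1) = v_{n+1} chat(n,i).  Hence for i > m0 the number
  c(i+k,i) is a positive multiple of
    v_0 ... v_{m0} + sum_{s <= k} eta_i ... eta_{i+s} chat(m0,m0-s).
  Passing from i to i+1 changes this by (eta_{i+1} - eta_i) sum_{s <= k} Q_s chat(m0,m0-s), whose
  sign does not depend on i.  Therefore the sequence is monotone in i, and it is nonnegative iff its
  first term or its limit, where every eta becomes K, is.
*)

theory Submission
  imports Defs
begin

section \<open>Determinants of tridiagonal matrices\<close>

text \<open>Positive determinant coefficients are part of the left-hand side itself, so
  hyponormality is never exploited; it only has to be deduced from the coefficient signs. What needs
  work is cutting infinitely many sign conditions down to finitely many. The value of m0 is forced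
  by how far the formulas look back. At a position p of the full weight sequence, the factorization
  of w_p involves weights from p - 1 on and the ratio v_p / u_p weights from p - 3 on. The Stampfli
  recursion starts at m, so p >= m + 1 and p >= m + 3 are required. For p = 2n or 2n + 1 this is
  guaranteed by n >= m0 and n > m0, respectively. The sign of the increments is independent of i
  because the relation between consecutive ratios, nonlinear in itself, makes their products satisfy
  a linear recurrence with constant coefficients. Conditions (ii) and (iii) collect the coefficients
  with i <= m0 that no closed formula reaches. Once n >= m0 + i, chat(n,i) vanishes and c(n,i) is
  just u_n c(n-1,i), so no new sign appears.\<close>

definition tridiag_mat :: "(nat \<Rightarrow> 'a::comm_ring_1) \<Rightarrow> (nat \<Rightarrow> 'a) \<Rightarrow> nat \<Rightarrow> 'a mat" where
  "tridiag_mat f g n = mat n n (\<lambda>(r, s).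
     if r = s then f r else if s = r + 1 then g r else if r = s + 1 then g s else 0)"

lemma det_tridiag_mat_Suc_0: "det (tridiag_mat f g (Suc 0)) = f 0"
  using det_single[of "tridiag_mat f g (Suc 0)"] by (simp add: tridiag_mat_def)

text \<open>Laplace expansion along the last row. The minor \<open>B\<close> of the off-diagonal
  entry is expanded once more, along its last column, where only the bottom entry is
  nonzero.\<close>

lemma det_tridiag_mat_Suc_Suc:
  "det (tridiag_mat f g (Suc (Suc n))) =
     f (Suc n) * det (tridiag_mat f g (Suc n)) - (g n)\<^sup>2 * det (tridiag_mat f g n)"
proof -
  let ?A = "tridiag_mat f g (Suc (Suc n))"
  define B where "B = mat_delete ?A (Suc n) n"
  have A: "?A \<in> carrier_mat (Suc (Suc n)) (Suc (Suc n))"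
    by (simp add: tridiag_mat_def)
  have B: "B \<in> carrier_mat (Suc n) (Suc n)"
    by (auto simp: B_def mat_delete_def tridiag_mat_def)
  have del_A: "mat_delete ?A (Suc n) (Suc n) = tridiag_mat f g (Suc n)"
    by (rule eq_matI) (auto simp: mat_delete_def tridiag_mat_def)
  have del_B: "mat_delete B n n = tridiag_mat f g n"
    by (rule eq_matI) (auto simp: B_def mat_delete_def tridiag_mat_def)
  have "det B = (\<Sum>i<Suc n. B $$ (i, n) * cofactor B i n)"
    by (rule laplace_expansion_column[OF B]) simp
  also have "\<dots> = B $$ (n, n) * cofactor B n n"
  proof -
    have "B $$ (i, n) = 0" if "i < n" for i
      using that by (auto simp: B_def mat_delete_def tridiag_mat_def)
    then show ?thesis by simp
  qed
  also have "\<dots> = g n * det (tridiag_mat f g n)"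
    by (simp add: cofactor_def del_B) (simp add: B_def mat_delete_def tridiag_mat_def)
  finally have det_B: "det B = g n * det (tridiag_mat f g n)" .
  have "det ?A = (\<Sum>j<Suc (Suc n). ?A $$ (Suc n, j) * cofactor ?A (Suc n) j)"
    by (rule laplace_expansion_row[OF A]) simp
  also have "\<dots> = ?A $$ (Suc n, n) * cofactor ?A (Suc n) n
      + ?A $$ (Suc n, Suc n) * cofactor ?A (Suc n) (Suc n)"
  proof -
    have "?A $$ (Suc n, j) = 0" if "j < n" for j
      using that by (auto simp: tridiag_mat_def)
    then show ?thesis by simp
  qed
  also have "?A $$ (Suc n, n) = g n"
    by (simp add: tridiag_mat_def)
  also have "?A $$ (Suc n, Suc n) = f (Suc n)"
    by (simp add: tridiag_mat_def)
  also have "cofactor ?A (Suc n) n = - (g n * det (tridiag_mat f g n))"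
    by (simp add: cofactor_def det_B flip: B_def)
  also have "cofactor ?A (Suc n) (Suc n) = det (tridiag_mat f g (Suc n))"
    by (simp add: cofactor_def del_A)
  finally show ?thesis by (simp add: power2_eq_square algebra_simps)
qed

section \<open>The determinant as a polynomial in t\<close>

fun tridiag_poly ::
  "(nat \<Rightarrow> real) \<Rightarrow> (nat \<Rightarrow> real) \<Rightarrow> (nat \<Rightarrow> real) \<Rightarrow> nat \<Rightarrow> real poly" where
  "tridiag_poly U V W 0 = 1"
| "tridiag_poly U V W (Suc 0) = [:U 0, V 0:]"
| "tridiag_poly U V W (Suc (Suc n)) =
     [:U (Suc n), V (Suc n):] * tridiag_poly U V W (Suc n) - [:0, W n:] * tridiag_poly U V W n"

text \<open>The shift by one reconciles two conventions: \<open>tridiag_poly\<close> counts rows,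
  starting from the empty determinant 1, while c(n,i) belongs to the matrix with rows 0 to
  n.\<close>

definition tridiag_coeff ::
  "(nat \<Rightarrow> real) \<Rightarrow> (nat \<Rightarrow> real) \<Rightarrow> (nat \<Rightarrow> real) \<Rightarrow> nat \<Rightarrow> nat \<Rightarrow> real" where
  "tridiag_coeff U V W n = coeff (tridiag_poly U V W (Suc n))"

lemma det_tridiag_mat_eq_poly:
  assumes "\<And>k. W k \<ge> 0" and "t \<ge> 0"
  shows "det (tridiag_mat (\<lambda>k. U k + V k * t) (\<lambda>k. sqrt (W k * t)) n) =
    poly (tridiag_poly U V W n) t"
proof (induction n rule: induct_nat_012)
  case 0
  show ?case by (simp add: tridiag_mat_def)
next
  case 1
  show ?case by (simp add: det_tridiag_mat_Suc_0 algebra_simps)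
next
  case (ge2 n)
  have "(sqrt (W n * t))\<^sup>2 = W n * t"
    using assms by simp
  with ge2 show ?case
    unfolding det_tridiag_mat_Suc_Suc by (simp add: algebra_simps)
qed

lemma coeff_pCons_times_Suc:
  fixes p :: "real poly"
  shows "coeff ([:a, b:] * p) (Suc i) = a * coeff p (Suc i) + b * coeff p i"
  by (simp add: mult_pCons_left coeff_pCons)

lemma coeff_pCons_times_0:
  fixes p :: "real poly"
  shows "coeff ([:a, b:] * p) 0 = a * coeff p 0"
  by (simp add: mult_pCons_left coeff_pCons)

lemma degree_tridiag_poly: "degree (tridiag_poly U V W n) \<le> n"
proof (induction n rule: induct_nat_012)
  case (ge2 n)
  have lin: "degree [:a, b:] \<le> 1" for a b :: real
    by simp
  have "degree ([:U (Suc n), V (Suc n):] * tridiag_poly U V W (Suc n)) \<le> Suc (Suc n)"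
    using degree_mult_le[of "[:U (Suc n), V (Suc n):]" "tridiag_poly U V W (Suc n)"]
      lin[of "U (Suc n)" "V (Suc n)"] ge2(2) by linarith
  moreover have "degree ([:0, W n:] * tridiag_poly U V W n) \<le> Suc (Suc n)"
    using degree_mult_le[of "[:0, W n:]" "tridiag_poly U V W n"] lin[of 0 "W n"] ge2(1)
    by linarith
  ultimately show ?case
    by (simp only: tridiag_poly.simps) (rule degree_diff_le)
qed auto

lemma tridiag_coeff_eq_0:
  "i > n + 1 \<Longrightarrow> tridiag_coeff U V W n i = 0"
  using degree_tridiag_poly[of U V W "Suc n"]
  by (simp add: tridiag_coeff_def coeff_eq_0)

lemma tridiag_coeff_0:
  "tridiag_coeff U V W n 0 = (\<Prod>k\<le>n. U k)"
proof -
  have "coeff (tridiag_poly U V W n) 0 = (\<Prod>k<n. U k)" for n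
    by (induction n rule: induct_nat_012)
      (auto simp: coeff_pCons_times_0 simp del: mult_pCons_left)
  then show ?thesis
    by (simp add: tridiag_coeff_def lessThan_Suc_atMost del: tridiag_poly.simps)
qed

text \<open>The last term stays a coefficient of \<open>tridiag_poly\<close>, because for n = 0 it
  belongs to the empty determinant, which \<open>tridiag_coeff\<close> cannot index.\<close>

lemma tridiag_coeff_Suc_Suc:
  "tridiag_coeff U V W (Suc n) (Suc i) =
     U (Suc n) * tridiag_coeff U V W n (Suc i) + V (Suc n) * tridiag_coeff U V W n i
     - W n * coeff (tridiag_poly U V W n) i"
  unfolding tridiag_coeff_def
  by (simp only: tridiag_poly.simps coeff_diff coeff_pCons_times_Suc mult_zero_left add_0_left)

text \<open>Terms using off-diagonal entries have degree at most n in the determinant with rows 0 to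
  n, so only the product of the diagonal reaches degree n + 1.\<close>

lemma tridiag_coeff_lead:
  "tridiag_coeff U V W n (Suc n) = (\<Prod>k\<le>n. V k)"
proof (induction n)
  case 0
  show ?case by (simp add: tridiag_coeff_def)
next
  case (Suc n)
  have "coeff (tridiag_poly U V W n) (Suc n) = 0"
    using degree_tridiag_poly[of U V W n] by (simp add: coeff_eq_0)
  then show ?case
    using Suc by (simp add: tridiag_coeff_Suc_Suc tridiag_coeff_eq_0)
qed

lemma poly_eq_if_eq_on_nonneg:
  fixes p q :: "real poly"
  assumes "\<And>t. t \<ge> 0 \<Longrightarrow> poly p t = poly q t"
  shows "p = q"
proof (rule ccontr)
  assume "p \<noteq> q"
  then have "finite {t. poly (p - q) t = 0}"
    by (intro poly_roots_finite) simp
  moreover have "{0..} \<subseteq> {t. poly (p - q) t = 0}"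
    using assms by auto
  ultimately have "finite {0::real..}"
    by (rule finite_subset[rotated])
  then show False
    using infinite_Ici by blast
qed

lemma w_br_nonneg: "w_br \<alpha> j k \<ge> 0"
  by (simp add: branch_def w_seq_def Let_def)

lemma det_poly_eq:
  "det_poly \<alpha> j n = tridiag_poly (u_br \<alpha> j) (v_br \<alpha> j) (w_br \<alpha> j) (Suc n)"
  (is "_ = ?p")
proof -
  have D: "D_mat \<alpha> j n t = tridiag_mat (\<lambda>k. u_br \<alpha> j k + v_br \<alpha> j k * t)
      (\<lambda>k. sqrt (w_br \<alpha> j k * t)) (Suc n)" for t
    by (simp add: D_mat_def tridiag_mat_def)
  have *: "det (D_mat \<alpha> j n t) = poly ?p t" if "t \<ge> 0" for t
    unfolding D using w_br_nonneg that by (rule det_tridiag_mat_eq_poly)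
  show ?thesis
    unfolding det_poly_def
  proof (rule the_equality)
    show "degree ?p \<le> n + 1 \<and> (\<forall>t\<ge>0. det (D_mat \<alpha> j n t) = poly ?p t)"
      using * degree_tridiag_poly[of _ _ _ "Suc n"] by simp
  next
    fix q
    assume "degree q \<le> n + 1 \<and> (\<forall>t\<ge>0. det (D_mat \<alpha> j n t) = poly q t)"
    then show "q = ?p"
      using * by (intro poly_eq_if_eq_on_nonneg) metis
  qed
qed

lemma c_coeff_eq:
  "c_coeff \<alpha> j = tridiag_coeff (u_br \<alpha> j) (v_br \<alpha> j) (w_br \<alpha> j)"
  by (simp add: fun_eq_iff c_coeff_def tridiag_coeff_def det_poly_eq del: tridiag_poly.simps)


section \<open>Coefficients with a factorizing tail\<close>

text \<open>Abstracts one branch of a backward extension, with \<open>N\<close> in the role of m0.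
  The Stampfli recursion enters through the factorization \<open>W_tail\<close> and the relation
  \<open>eta_rec\<close>. Up to index \<open>N\<close> the U's may vanish, as happens when prepended
  weights coincide.\<close>

locale tridiag_tail =
  fixes U V W :: "nat \<Rightarrow> real" and N :: nat and A B K :: real
  assumes U_nonneg: "\<And>n. U n \<ge> 0" and V_pos: "\<And>n. V n > 0"
    and U_pos: "\<And>n. n > N \<Longrightarrow> U n > 0" and N_pos: "N > 0"
    and W_tail: "\<And>n. n \<ge> N \<Longrightarrow> W n = U n * V (Suc n)"
    and eta_rec: "\<And>n. n > N \<Longrightarrow> V (Suc n) / U (Suc n) * (V n / U n) = A * (V n / U n) - B"
    and eta_less: "\<And>n. n > N \<Longrightarrow> V n / U n < V (Suc n) / U (Suc n)"
    and eta_lim: "(\<lambda>n. V n / U n) \<longlonglongrightarrow> K"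
begin

abbreviation "c \<equiv> tridiag_coeff U V W"

definition ch :: "nat \<Rightarrow> nat \<Rightarrow> real" where
  "ch n i = c n i - U n * c (n - 1) i"

definition \<eta> :: "nat \<Rightarrow> real" where
  "\<eta> n = V n / U n"

definition \<eta>_prod :: "nat \<Rightarrow> nat \<Rightarrow> real" where
  "\<eta>_prod l k = (\<Prod>r\<le>k. \<eta> (l + r))"

definition Q :: "nat \<Rightarrow> real" where
  "Q k = (\<eta>_prod (Suc (Suc N)) k - \<eta>_prod (Suc N) k) / (\<eta> (Suc (Suc N)) - \<eta> (Suc N))"

text \<open>For l > N and k \<le> N this is c(l + k, l) up to a positive factor; see
  \<open>c_eq_F\<close>. The product of the V's is the leading coefficient c(N, N + 1).\<close>

definition F :: "nat \<Rightarrow> nat \<Rightarrow> real" where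
  "F l k = (\<Prod>r\<le>N. V r) + (\<Sum>s\<le>k. \<eta>_prod l s * ch N (N - s))"

definition F_slope :: "nat \<Rightarrow> real" where
  "F_slope k = (\<Sum>s\<le>k. Q s * ch N (N - s))"

definition F_lim :: "nat \<Rightarrow> real" where
  "F_lim k = (\<Prod>r\<le>N. V r) + (\<Sum>s\<le>k. K ^ (s + 1) * ch N (N - s))"

text \<open>By \<open>W_tail\<close> the last two terms of the three-term recursion share the factor
  \<open>V (Suc n)\<close>, and what they leave is exactly \<open>ch n i\<close>.\<close>

lemma ch_step:
  assumes "n \<ge> N"
  shows "ch (Suc n) (Suc i) = V (Suc n) * ch n i"
proof -
  from assms N_pos obtain n' where n': "n = Suc n'"
    by (cases n) auto
  then show ?thesis
    using W_tail[OF assms] tridiag_coeff_Suc_Suc[of U V W n i]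
    by (simp add: ch_def tridiag_coeff_def algebra_simps del: tridiag_poly.simps)
qed

text \<open>Constant coefficients are products of U's, so passing from n - 1 to n multiplies them by
  U n.\<close>

lemma ch_0: "n > 0 \<Longrightarrow> ch n 0 = 0"
  by (cases n) (simp_all add: ch_def tridiag_coeff_0)

lemma ch_shift:
  "n \<ge> N \<Longrightarrow> ch (n + d) (i + d) = (\<Prod>r<d. V (Suc n + r)) * ch n i"
  by (induction d) (simp_all add: ch_step)

text \<open>Going back i steps along the diagonal reaches column 0 in row n - i, which is still at
  least N.\<close>

lemma ch_eq_0:
  assumes "n \<ge> N + i"
  shows "ch n i = 0"
  using ch_shift[of "n - i" i 0] ch_0[of "n - i"] assms N_pos by simp

lemma c_Suc: "c (Suc n) i = U (Suc n) * c n i + ch (Suc n) i"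
  by (simp add: ch_def)

lemma V_eq: "n > N \<Longrightarrow> V n = U n * \<eta> n"
  using U_pos[of n] by (simp add: \<eta>_def)

text \<open>Every V from index N + 1 + e on is split as U times \<open>\<eta>\<close>. The U's match
  the factors that c picks up under \<open>c_Suc\<close>; the ratios become the weights in
  \<open>F\<close>.\<close>

lemma prod_V_split:
  "(\<Prod>r<Suc (e + k). V (Suc N + r)) =
     (\<Prod>r<e. V (Suc N + r)) * (\<Prod>r\<le>k. U (Suc N + e + r)) * \<eta>_prod (Suc N + e) k"
  by (induction k) (simp_all add: \<eta>_prod_def V_eq add.assoc)

text \<open>Unrolls \<open>c_Suc\<close> down the column i = N + 1 + e. The start is the leading
  coefficient in row i - 1; row i + s adds \<open>ch (i + s) i\<close>, which
  \<open>ch_shift\<close> traces back along the diagonal to \<open>ch N (N - s)\<close>.\<close>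

lemma c_eq_F:
  assumes "k \<le> N"
  shows "c (Suc N + e + k) (Suc N + e) =
    (\<Prod>r\<le>k. U (Suc N + e + r)) * (\<Prod>r<e. V (Suc N + r)) * F (Suc N + e) k"
  using assms
proof (induction k)
  case 0
  have lead: "c (N + e) (Suc (N + e)) = (\<Prod>r\<le>N. V r) * (\<Prod>r<e. V (Suc N + r))"
    unfolding tridiag_coeff_lead by (induction e) auto
  have "ch (N + Suc e) (N + Suc e) = (\<Prod>r<Suc (e + 0). V (Suc N + r)) * ch N N"
    using ch_shift[of N "Suc e" N] by simp
  then show ?case
    using c_Suc[of "N + e" "Suc (N + e)"] lead unfolding prod_V_split
    by (simp add: F_def algebra_simps)
next
  case (Suc k)
  \<comment> \<open>The new entry lies e + k + 2 diagonal steps beyond row N, column N - Suc k; the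
    bound \<open>Suc k \<le> N\<close> makes the truncated subtraction exact.\<close>
  have n: "Suc (Suc N + e + k) = N + Suc (e + Suc k)"
    and i: "Suc N + e = N - Suc k + Suc (e + Suc k)"
    using Suc.prems by simp_all
  have "ch (Suc (Suc N + e + k)) (Suc N + e) =
      (\<Prod>r<Suc (e + Suc k). V (Suc N + r)) * ch N (N - Suc k)"
    by (subst n, subst i) (rule ch_shift, simp)
  then have ch: "ch (Suc (Suc N + e + k)) (Suc N + e) =
      (\<Prod>r<e. V (Suc N + r)) * (\<Prod>r\<le>Suc k. U (Suc N + e + r)) * \<eta>_prod (Suc N + e) (Suc k)
      * ch N (N - Suc k)"
    unfolding prod_V_split .
  have F: "F (Suc N + e) (Suc k) =
      F (Suc N + e) k + \<eta>_prod (Suc N + e) (Suc k) * ch N (N - Suc k)"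
    by (simp add: F_def)
  have IH: "c (Suc N + e + k) (Suc N + e) =
      (\<Prod>r\<le>k. U (Suc N + e + r)) * (\<Prod>r<e. V (Suc N + r)) * F (Suc N + e) k"
    using Suc by simp
  have "c (Suc (Suc N + e + k)) (Suc N + e) =
      (\<Prod>r\<le>Suc k. U (Suc N + e + r)) * (\<Prod>r<e. V (Suc N + r)) * F (Suc N + e) (Suc k)"
    unfolding c_Suc IH ch F prod.atMost_Suc add_Suc_right
    by (simp only: algebra_simps)
  then show ?case by simp
qed

lemma c_nonneg_iff_F:
  assumes "k \<le> N"
  shows "c (Suc N + e + k) (Suc N + e) \<ge> 0 \<longleftrightarrow> F (Suc N + e) k \<ge> 0"
proof -
  have "0 \<le> p * z \<longleftrightarrow> 0 \<le> z" if "p > 0" for p z :: real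
    using that by (simp add: zero_le_mult_iff)
  moreover have "(\<Prod>r\<le>k. U (Suc N + e + r)) * (\<Prod>r<e. V (Suc N + r)) > 0"
    by (intro mult_pos_pos prod_pos) (auto intro: U_pos V_pos)
  ultimately show ?thesis
    unfolding c_eq_F[OF assms] by blast
qed

text \<open>\<open>eta_rec\<close> rewrites the product of the last two factors. The result is
  linear, and its coefficients do not depend on the starting index l.\<close>

lemma eta_prod_rec:
  assumes "l > N"
  shows "\<eta>_prod l (Suc (Suc k)) = A * \<eta>_prod l (Suc k) - B * \<eta>_prod l k"
proof -
  have "\<eta> (Suc (l + Suc k)) * \<eta> (l + Suc k) = A * \<eta> (l + Suc k) - B"
    using eta_rec[of "l + Suc k"] assms unfolding \<eta>_def by simp
  moreover have "\<eta>_prod l (Suc (Suc k)) = \<eta>_prod l k * (\<eta> (Suc (l + Suc k)) * \<eta> (l + Suc k))"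
    by (simp add: \<eta>_prod_def)
  moreover have "\<eta>_prod l (Suc k) = \<eta>_prod l k * \<eta> (l + Suc k)"
    by (simp add: \<eta>_prod_def)
  ultimately show ?thesis by (simp only: right_diff_distrib mult_ac)
qed

text \<open>The increments in l inherit the recurrence in k. For k = 0 and k = 1 they are 1 and A
  times the increment of \<open>\<eta>\<close>, so for every k they are a multiple of it, with one
  multiplier serving all l. This is why \<open>Q\<close> may be read off at l = N + 1.\<close>

lemma eta_prod_diff:
  assumes "l > N"
  shows "\<eta>_prod (Suc l) k - \<eta>_prod l k = Q k * (\<eta> (Suc l) - \<eta> l)"
proof -
  have ex: "\<exists>q. \<forall>l>N. \<eta>_prod (Suc l) k - \<eta>_prod l k = q * (\<eta> (Suc l) - \<eta> l)" for k
  proof (induction k rule: induct_nat_012)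
    case 0
    have "\<forall>l>N. \<eta>_prod (Suc l) 0 - \<eta>_prod l 0 = 1 * (\<eta> (Suc l) - \<eta> l)"
      by (simp add: \<eta>_prod_def)
    then show ?case by blast
  next
    case 1
    have "\<eta>_prod l (Suc 0) = A * \<eta> l - B" if "l > N" for l
      using eta_rec[OF that] by (simp add: \<eta>_prod_def \<eta>_def mult.commute)
    then have "\<forall>l>N. \<eta>_prod (Suc l) (Suc 0) - \<eta>_prod l (Suc 0) = A * (\<eta> (Suc l) - \<eta> l)"
      by (simp add: right_diff_distrib)
    then show ?case by blast
  next
    case (ge2 k)
    from ge2 obtain q q' where
      "\<And>l. l > N \<Longrightarrow> \<eta>_prod (Suc l) k - \<eta>_prod l k = q * (\<eta> (Suc l) - \<eta> l)"
      "\<And>l. l > N \<Longrightarrow> \<eta>_prod (Suc l) (Suc k) - \<eta>_prod l (Suc k) = q' * (\<eta> (Suc l) - \<eta> l)"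
      by blast
    moreover have "\<eta>_prod (Suc l) (Suc (Suc k)) - \<eta>_prod l (Suc (Suc k)) =
        A * (\<eta>_prod (Suc l) (Suc k) - \<eta>_prod l (Suc k)) - B * (\<eta>_prod (Suc l) k - \<eta>_prod l k)"
      if "l > N" for l
      using that by (simp add: eta_prod_rec algebra_simps)
    ultimately have "\<eta>_prod (Suc l) (Suc (Suc k)) - \<eta>_prod l (Suc (Suc k)) =
        (A * q' - B * q) * (\<eta> (Suc l) - \<eta> l)" if "l > N" for l
      using that by (simp only: left_diff_distrib mult.assoc)
    then show ?case by blast
  qed
  from ex obtain q where q: "\<forall>l>N. \<eta>_prod (Suc l) k - \<eta>_prod l k = q * (\<eta> (Suc l) - \<eta> l)"
    by blast
  moreover have "\<eta> (Suc (Suc N)) - \<eta> (Suc N) > 0"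
    using eta_less[of "Suc N"] by (simp add: \<eta>_def)
  \<comment> \<open>At l = N + 1 the strict growth of the ratios allows division by their
    increment.\<close>
  ultimately have "Q k = q"
    by (simp add: Q_def)
  with q assms show ?thesis by blast
qed

lemma F_diff:
  assumes "l > N"
  shows "F (Suc l) k - F l k = F_slope k * (\<eta> (Suc l) - \<eta> l)"
proof -
  have "F (Suc l) k - F l k = (\<Sum>s\<le>k. (\<eta>_prod (Suc l) s - \<eta>_prod l s) * ch N (N - s))"
    by (simp add: F_def left_diff_distrib sum_subtractf)
  also have "\<dots> = (\<Sum>s\<le>k. Q s * ch N (N - s) * (\<eta> (Suc l) - \<eta> l))"
    by (simp add: eta_prod_diff[OF assms] algebra_simps)
  finally show ?thesis
    by (simp add: F_slope_def sum_distrib_right)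
qed

lemma F_tendsto: "(\<lambda>e. F (Suc N + e) k) \<longlonglongrightarrow> F_lim k"
proof -
  have eta: "(\<lambda>e. \<eta> (Suc N + e + r)) \<longlonglongrightarrow> K" for r
  proof -
    have "(\<lambda>e. \<eta> (e + (Suc N + r))) \<longlonglongrightarrow> K"
      using eta_lim unfolding \<eta>_def by (rule LIMSEQ_ignore_initial_segment)
    moreover have "e + (Suc N + r) = Suc N + e + r" for e
      by simp
    ultimately show ?thesis by (simp only:)
  qed
  have "(\<lambda>e. \<eta>_prod (Suc N + e) s) \<longlonglongrightarrow> (\<Prod>r\<le>s. K)" for s
    unfolding \<eta>_prod_def by (intro tendsto_prod eta)
  then show ?thesis
    unfolding F_def F_lim_def by (intro tendsto_intros) simp
qed

text \<open>The product formula for the increments makes \<open>F l k\<close> monotone in \<open>l\<close>, in the direction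
  given by the sign of \<open>F_slope k\<close>; so its infimum is its first value or its limit.\<close>

lemma F_nonneg_iff:
  "(\<forall>e. F (Suc N + e) k \<ge> 0) \<longleftrightarrow>
     (F_slope k \<ge> 0 \<and> F (Suc N) k \<ge> 0) \<or> (F_slope k \<le> 0 \<and> F_lim k \<ge> 0)"
proof
  assume *: "\<forall>e. F (Suc N + e) k \<ge> 0"
  then have "F_lim k \<ge> 0"
    by (intro LIMSEQ_le_const[OF F_tendsto]) blast
  then show "(F_slope k \<ge> 0 \<and> F (Suc N) k \<ge> 0) \<or> (F_slope k \<le> 0 \<and> F_lim k \<ge> 0)"
    using *[rule_format, of 0] by auto
next
  have inc: "\<eta> (Suc (Suc N + e)) - \<eta> (Suc N + e) \<ge> 0" for e
    using eta_less[of "Suc N + e"] by (simp add: \<eta>_def)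
  assume "(F_slope k \<ge> 0 \<and> F (Suc N) k \<ge> 0) \<or> (F_slope k \<le> 0 \<and> F_lim k \<ge> 0)"
  then show "\<forall>e. F (Suc N + e) k \<ge> 0"
  proof (elim disjE conjE)
    assume slope: "F_slope k \<ge> 0" and base: "F (Suc N) k \<ge> 0"
    have "F (Suc N + e) k \<ge> 0" for e
    proof (induction e)
      case (Suc e)
      have "F (Suc (Suc N + e)) k - F (Suc N + e) k \<ge> 0"
        using F_diff[of "Suc N + e" k] slope inc[of e] by simp
      with Suc show ?case by simp
    qed (use base in simp)
    then show ?thesis by blast
  next
    assume slope: "F_slope k \<le> 0" and lim: "F_lim k \<ge> 0"
    have "decseq (\<lambda>e. F (Suc N + e) k)"
    proof (rule decseq_SucI)
      fix e
      have "F (Suc (Suc N + e)) k - F (Suc N + e) k \<le> 0"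
        using F_diff[of "Suc N + e" k] slope inc[of e] by (simp add: mult_nonpos_nonneg)
      then show "F (Suc N + Suc e) k \<le> F (Suc N + e) k" by simp
    qed
    then have "F_lim k \<le> F (Suc N + e) k" for e
      using F_tendsto by (rule decseq_ge)
    with lim show ?thesis by (metis order_trans)
  qed
qed

text \<open>Sorted by columns. Column 0 and the leading coefficients are products of U's or V's. A
  column i > N is governed by \<open>F\<close> in rows i + k with k < N. A column i with 1 \<le> i
  \<le> N is listed explicitly in the rows n with i \<le> n < N + i. From row N + i on, each further
  entry of either kind of column is the previous one times U n.\<close>

theorem coeffs_nonneg_iff:
  "(\<forall>n. \<forall>i\<le>n + 1. c n i \<ge> 0) \<longleftrightarrow>
     (\<forall>k\<le>N - 1. (F_slope k \<ge> 0 \<and> c (N + 1 + k) (N + 1) \<ge> 0) \<or> (F_slope k \<le> 0 \<and> F_lim k \<ge> 0)) \<and>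
     (\<forall>n\<in>{1..N}. \<forall>i\<in>{1..n}. c n i \<ge> 0) \<and>
     (\<forall>n\<in>{N + 1..2 * N - 1}. \<forall>i\<in>{n + 1 - N..N}. c n i \<ge> 0)"
  (is "?L \<longleftrightarrow> ?a \<and> ?b \<and> ?d")
proof -
  have a_iff: "?a \<longleftrightarrow> (\<forall>k\<le>N - 1. \<forall>e. F (Suc N + e) k \<ge> 0)"
  proof -
    have "c (N + 1 + k) (N + 1) \<ge> 0 \<longleftrightarrow> F (Suc N) k \<ge> 0" if "k \<le> N - 1" for k
      using c_nonneg_iff_F[of k 0] that by simp
    then show ?thesis
      unfolding F_nonneg_iff by simp
  qed
  show ?thesis
  proof (intro iffI conjI)
    assume L: ?L
    show ?a
      unfolding a_iff using c_nonneg_iff_F L by auto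
    show ?b ?d
      using L by auto
  next
    assume R: "?a \<and> ?b \<and> ?d"
    have low: "c n i \<ge> 0" if "i \<le> N" "n \<ge> 1" "i \<ge> 1" "i \<le> n" for n i
      using that
    proof (induction n)
      case (Suc n)
      show ?case
      proof (cases "Suc n \<ge> N + i")
        case True
        then have "c (Suc n) i = U (Suc n) * c n i"
          by (simp add: c_Suc ch_eq_0)
        moreover have "c n i \<ge> 0"
          using Suc True N_pos by simp
        ultimately show ?thesis using U_nonneg by simp
      next
        case False
        then show ?thesis
        proof (cases "Suc n \<le> N")
          case True
          then have "Suc n \<in> {1..N}" "i \<in> {1..Suc n}"
            using Suc.prems by auto
          then show ?thesis using R by blast
        next
          case nle: False
          have "Suc n \<in> {N + 1..2 * N - 1}" "i \<in> {Suc n + 1 - N..N}"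
            using Suc.prems False nle by auto
          then show ?thesis using R by blast
        qed
      qed
    qed simp
    have high: "c (Suc N + e + k) (Suc N + e) \<ge> 0" for e k
    proof (induction k)
      case 0
      show ?case
        using a_iff R c_nonneg_iff_F[of 0 e] by simp
    next
      case (Suc k)
      show ?case
      proof (cases "Suc k \<le> N - 1")
        case True
        then show ?thesis
          using a_iff R c_nonneg_iff_F[of "Suc k" e] by simp
      next
        case False
        then have "ch (Suc (Suc N + e + k)) (Suc N + e) = 0"
          by (intro ch_eq_0) simp
        then show ?thesis
          using Suc U_nonneg c_Suc[of "Suc N + e + k" "Suc N + e"] by simp
      qed
    qed
    show ?L
    proof (intro allI impI)
      fix n i :: nat
      assume i: "i \<le> n + 1"
      consider "i = 0" | "i = n + 1" | "1 \<le> i" "i \<le> n" "i \<le> N" | "1 \<le> i" "i \<le> n" "i > N"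
        using i by linarith
      then show "c n i \<ge> 0"
      proof cases
        case 1
        then show ?thesis by (simp add: tridiag_coeff_0 prod_nonneg U_nonneg)
      next
        case 2
        have "(\<Prod>k\<le>n. V k) \<ge> 0"
          by (intro prod_nonneg) (simp add: V_pos less_imp_le)
        with 2 show ?thesis by (simp add: tridiag_coeff_lead)
      next
        case 3
        then show ?thesis using low by simp
      next
        case 4
        then show ?thesis using high[of "i - Suc N" "n - i"] by simp
      qed
    qed
  qed
qed

end


section \<open>Hyponormality of $W_\alpha+sW_\alpha^3$\<close>

lemma norm_add_sq_le: "(cmod (a + b))\<^sup>2 \<le> 2 * ((cmod a)\<^sup>2 + (cmod b)\<^sup>2)"
proof -
  have "(cmod (a + b))\<^sup>2 \<le> (cmod a + cmod b)\<^sup>2"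
    by (intro power_mono norm_triangle_ineq) simp
  also have "\<dots> \<le> 2 * ((cmod a)\<^sup>2 + (cmod b)\<^sup>2)"
    using sum_squares_bound[of "cmod a" "cmod b"] by (simp add: power2_sum)
  finally show ?thesis .
qed

lemma ell2_add:
  assumes "x \<in> ell2" "y \<in> ell2"
  shows "(\<lambda>n. x n + y n) \<in> ell2"
proof -
  have "summable (\<lambda>n. 2 * ((cmod (x n))\<^sup>2 + (cmod (y n))\<^sup>2))"
    using assms by (intro summable_mult summable_add) (simp_all add: ell2_def)
  then have "summable (\<lambda>n. (cmod (x n + y n))\<^sup>2)"
    by (rule summable_comparison_test'[where N = 0]) (use norm_add_sq_le in simp)
  then show ?thesis by (simp add: ell2_def)
qed

lemma ell2_product_summable:
  assumes "x \<in> ell2" "y \<in> ell2"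
  shows "summable (\<lambda>n. x n * cnj (y n))"
proof (rule summable_comparison_test')
  show "summable (\<lambda>n. (cmod (x n))\<^sup>2 + (cmod (y n))\<^sup>2)"
    using assms by (intro summable_add) (auto simp: ell2_def)
  show "norm (x n * cnj (y n)) \<le> (cmod (x n))\<^sup>2 + (cmod (y n))\<^sup>2" if "n \<ge> 0" for n
    using sum_squares_bound[of "cmod (x n)" "cmod (y n)"]
      mult_nonneg_nonneg[of "cmod (x n)" "cmod (y n)"]
    by (simp add: norm_mult del: mult_nonneg_nonneg)
qed

lemma ell2_inner_self:
  assumes "x \<in> ell2"
  shows "ell2_inner x x = complex_of_real (\<Sum>n. (cmod (x n))\<^sup>2)"
proof -
  have "(\<lambda>n. complex_of_real ((cmod (x n))\<^sup>2)) sums complex_of_real (\<Sum>n. (cmod (x n))\<^sup>2)"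
    using assms by (intro sums_of_real summable_sums) (simp add: ell2_def)
  then show ?thesis
    by (simp add: ell2_inner_def complex_norm_square[symmetric] sums_iff)
qed

lemma ell2_inner_cnj:
  assumes "x \<in> ell2" "y \<in> ell2"
  shows "ell2_inner y x = cnj (ell2_inner x y)"
proof -
  have "(\<lambda>n. cnj (x n * cnj (y n))) sums cnj (ell2_inner x y)"
    unfolding ell2_inner_def sums_cnj by (intro summable_sums ell2_product_summable assms)
  then show ?thesis
    by (simp add: ell2_inner_def sums_iff mult.commute)
qed

lemma ell2_delta: "(\<lambda>k. if k = n then 1 else 0) \<in> ell2"
proof -
  have "summable (\<lambda>k. (cmod (if k = n then 1 else 0))\<^sup>2)"
    by (rule summable_finite[of "{n}"]) auto
  then show ?thesis by (simp add: ell2_def)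
qed

lemma ell2_inner_delta: "ell2_inner (\<lambda>k. if k = n then 1 else 0) y = cnj (y n)"
proof -
  have "(\<Sum>k. (if k = n then 1 else 0) * cnj (y k)) =
      (\<Sum>k\<in>{n}. (if k = n then 1 else 0) * cnj (y k))"
    by (rule suminf_finite) auto
  then show ?thesis by (simp add: ell2_inner_def)
qed

text \<open>Any two adjoints have the same inner products with the unit vectors, so they agree
  coordinatewise; on \<open>ell2\<close> the choice in \<open>operator_adjoint\<close> is thus
  forced.\<close>

lemma operator_adjoint_eq:
  assumes S: "bounded_operator S"
    and adj: "\<And>x y. x \<in> ell2 \<Longrightarrow> y \<in> ell2 \<Longrightarrow> ell2_inner (T x) y = ell2_inner x (S y)"
    and y: "y \<in> ell2"
  shows "operator_adjoint T y = S y"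
proof -
  let ?P = "\<lambda>S. bounded_operator S \<and>
     (\<forall>x\<in>ell2. \<forall>y\<in>ell2. ell2_inner (T x) y = ell2_inner x (S y))"
  have "?P (operator_adjoint T)"
    unfolding operator_adjoint_def using S adj by (intro someI[of ?P S]) blast
  then have "ell2_inner x (operator_adjoint T y) = ell2_inner x (S y)" if "x \<in> ell2" for x
    using that y adj by metis
  from this[OF ell2_delta] show ?thesis
    by (simp add: ell2_inner_delta fun_eq_iff)
qed

text \<open>The quadratic form of the self-commutator at x is the squared norm of T x minus that of
  the adjoint applied to x, so a norm comparison with an explicit adjoint suffices.\<close>

lemma hyponormalI:
  assumes T: "bounded_operator T" and S: "bounded_operator S"
    and adj: "\<And>x y. x \<in> ell2 \<Longrightarrow> y \<in> ell2 \<Longrightarrow> ell2_inner (T x) y = ell2_inner x (S y)"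
    and le: "\<And>x. x \<in> ell2 \<Longrightarrow> (\<Sum>n. (cmod (S x n))\<^sup>2) \<le> (\<Sum>n. (cmod (T x n))\<^sup>2)"
  shows "hyponormal T"
  unfolding hyponormal_def positive_operator_def
proof (intro conjI ballI T)
  fix x
  assume x: "x \<in> ell2"
  have Tx: "T x \<in> ell2" and Sx: "S x \<in> ell2" and STx: "S (T x) \<in> ell2" and TSx: "T (S x) \<in> ell2"
    using T S x by (simp_all add: bounded_operator_def)
  have eq: "operator_adjoint T (T x) = S (T x)" "operator_adjoint T x = S x"
    using operator_adjoint_eq[OF S adj] Tx x by blast+
  have "ell2_inner (\<lambda>n. S (T x) n - T (S x) n) x = ell2_inner (S (T x)) x - ell2_inner (T (S x)) x"
    using suminf_diff[OF ell2_product_summable[OF STx x] ell2_product_summable[OF TSx x]]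
    by (simp add: ell2_inner_def left_diff_distrib)
  also have "ell2_inner (S (T x)) x = cnj (ell2_inner (T x) (T x))"
    using ell2_inner_cnj[OF x STx] adj[OF x Tx] by simp
  also have "\<dots> = complex_of_real (\<Sum>n. (cmod (T x n))\<^sup>2)"
    using ell2_inner_self[OF Tx] by simp
  also have "ell2_inner (T (S x)) x = complex_of_real (\<Sum>n. (cmod (S x n))\<^sup>2)"
    using adj[OF Sx x] ell2_inner_self[OF Sx] by simp
  finally have *: "ell2_inner (\<lambda>n. operator_adjoint T (T x) n - T (operator_adjoint T x) n) x =
      complex_of_real ((\<Sum>n. (cmod (T x n))\<^sup>2) - (\<Sum>n. (cmod (S x n))\<^sup>2))"
    by (simp add: eq)
  show "ell2_inner (\<lambda>n. operator_adjoint T (T x) n - T (operator_adjoint T x) n) x \<in> \<real>"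
    unfolding * by simp
  show "0 \<le> Re (ell2_inner (\<lambda>n. operator_adjoint T (T x) n - T (operator_adjoint T x) n) x)"
    unfolding * using le[OF x] by simp
qed

section \<open>Weighted forward and backward translations\<close>

definition raise :: "(nat \<Rightarrow> complex) \<Rightarrow> nat \<Rightarrow> (nat \<Rightarrow> complex) \<Rightarrow> nat \<Rightarrow> complex" where
  "raise a d x n = (if n < d then 0 else a (n - d) * x (n - d))"

text \<open>With conjugated coefficients this is the adjoint of \<open>raise\<close>. The operators
  W and s W^3 are \<open>raise\<close> with distance 1 and 3.\<close>

definition lower :: "(nat \<Rightarrow> complex) \<Rightarrow> nat \<Rightarrow> (nat \<Rightarrow> complex) \<Rightarrow> nat \<Rightarrow> complex" where
  "lower a d x n = a n * x (n + d)"

lemma sums_raise_shift: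
  fixes f :: "nat \<Rightarrow> 'a::real_normed_vector"
  assumes "\<And>n. n < d \<Longrightarrow> f n = 0"
  shows "f sums s \<longleftrightarrow> (\<lambda>n. f (n + d)) sums s"
  using assms by (simp add: sums_iff_shift)

lemma bounded_operatorI:
  assumes "\<And>x y n. T (\<lambda>n. x n + y n) n = T x n + T y n"
    and "\<And>a x n. T (\<lambda>n. a * x n) n = a * T x n"
    and bound: "\<And>x. x \<in> ell2 \<Longrightarrow> \<exists>s. (\<lambda>n. (cmod (T x n))\<^sup>2) sums s \<and> s \<le> C * (\<Sum>n. (cmod (x n))\<^sup>2)"
    and "C \<ge> 0"
  shows "bounded_operator T"
  unfolding bounded_operator_def
proof (intro conjI ballI allI exI)
  fix x y :: "nat \<Rightarrow> complex" and a :: complex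
  show "T (\<lambda>n. x n + y n) = (\<lambda>n. T x n + T y n)" "T (\<lambda>n. a * x n) = (\<lambda>n. a * T x n)"
    using assms by auto
next
  fix x
  assume x: "x \<in> ell2"
  from bound[OF x] obtain s where s: "(\<lambda>n. (cmod (T x n))\<^sup>2) sums s"
    "s \<le> C * (\<Sum>n. (cmod (x n))\<^sup>2)" by blast
  then show "T x \<in> ell2"
    by (auto simp: ell2_def sums_iff)
  have "(\<Sum>n. (cmod (T x n))\<^sup>2) \<le> C * (\<Sum>n. (cmod (x n))\<^sup>2)"
    using s by (simp add: sums_iff)
  then show "ell2_norm (T x) \<le> sqrt C * ell2_norm x"
    unfolding ell2_norm_def real_sqrt_mult[symmetric] by (rule real_sqrt_le_mono)
qed

lemma coeff_sq_le:
  assumes "cmod a \<le> C"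
  shows "(cmod (a * z))\<^sup>2 \<le> C\<^sup>2 * (cmod z)\<^sup>2"
proof -
  have "(cmod a)\<^sup>2 \<le> C\<^sup>2"
    using assms by (intro power_mono) auto
  then show ?thesis
    by (simp add: norm_mult power_mult_distrib mult_right_mono)
qed

lemma raise_bounded:
  assumes a: "\<And>n. cmod (a n) \<le> C"
  shows "bounded_operator (raise a d)"
proof (rule bounded_operatorI[where C = "C\<^sup>2"])
  fix x
  assume x: "x \<in> ell2"
  have sx: "summable (\<lambda>n. C\<^sup>2 * (cmod (x n))\<^sup>2)"
    using x by (intro summable_mult) (simp add: ell2_def)
  then have "summable (\<lambda>n. (cmod (a n * x n))\<^sup>2)"
    by (rule summable_comparison_test'[where N = 0]) (use coeff_sq_le[OF a] in auto)
  then have s: "(\<lambda>n. (cmod (a n * x n))\<^sup>2) sums (\<Sum>n. (cmod (a n * x n))\<^sup>2)"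
    by (rule summable_sums)
  then have "(\<lambda>n. (cmod (raise a d x n))\<^sup>2) sums (\<Sum>n. (cmod (a n * x n))\<^sup>2)"
    by (subst sums_raise_shift[of d]) (simp_all add: raise_def)
  moreover have "(\<Sum>n. (cmod (a n * x n))\<^sup>2) \<le> C\<^sup>2 * (\<Sum>n. (cmod (x n))\<^sup>2)"
    using x s sx coeff_sq_le[OF a]
    by (subst suminf_mult[symmetric]) (auto simp: ell2_def sums_iff intro!: suminf_le)
  ultimately show "\<exists>s. (\<lambda>n. (cmod (raise a d x n))\<^sup>2) sums s \<and> s \<le> C\<^sup>2 * (\<Sum>n. (cmod (x n))\<^sup>2)"
    by blast
qed (auto simp: raise_def algebra_simps)

lemma lower_bounded:
  assumes a: "\<And>n. cmod (a n) \<le> C"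
  shows "bounded_operator (lower a d)"
proof (rule bounded_operatorI[where C = "C\<^sup>2"])
  fix x
  assume x: "x \<in> ell2"
  then have sx: "summable (\<lambda>n. (cmod (x n))\<^sup>2)"
    by (simp add: ell2_def)
  then have sx': "summable (\<lambda>n. C\<^sup>2 * (cmod (x (n + d)))\<^sup>2)"
    by (intro summable_mult) (rule summable_ignore_initial_segment)
  then have s: "summable (\<lambda>n. (cmod (a n * x (n + d)))\<^sup>2)"
    by (rule summable_comparison_test'[where N = 0]) (use coeff_sq_le[OF a] in auto)
  have "(\<Sum>n. (cmod (a n * x (n + d)))\<^sup>2) \<le> (\<Sum>n. C\<^sup>2 * (cmod (x (n + d)))\<^sup>2)"
    using s sx' coeff_sq_le[OF a] by (intro suminf_le) auto
  also have "\<dots> = C\<^sup>2 * (\<Sum>n. (cmod (x (n + d)))\<^sup>2)"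
    using sx by (intro suminf_mult) (rule summable_ignore_initial_segment)
  also have "\<dots> \<le> C\<^sup>2 * (\<Sum>n. (cmod (x n))\<^sup>2)"
    using suminf_split_initial_segment[OF sx, of d]
    by (intro mult_left_mono) (auto intro: sum_nonneg)
  finally show "\<exists>s. (\<lambda>n. (cmod (lower a d x n))\<^sup>2) sums s \<and> s \<le> C\<^sup>2 * (\<Sum>n. (cmod (x n))\<^sup>2)"
    using s unfolding lower_def by (blast intro: summable_sums)
qed (auto simp: lower_def algebra_simps)

text \<open>The crude pointwise bound \<open>norm_add_sq_le\<close> takes the place of the triangle
  inequality for the norm; any constant will do.\<close>

lemma bounded_operator_add:
  assumes T: "bounded_operator T" and R: "bounded_operator R"
  shows "bounded_operator (\<lambda>x n. T x n + R x n)"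
  unfolding bounded_operator_def
proof (intro conjI ballI allI)
  fix x y :: "nat \<Rightarrow> complex" and a :: complex
  assume x: "x \<in> ell2"
  show "(\<lambda>n. T x n + R x n) \<in> ell2"
    using x T R by (intro ell2_add) (auto simp: bounded_operator_def)
  show "(\<lambda>n. T (\<lambda>n. a * x n) n + R (\<lambda>n. a * x n) n) = (\<lambda>n. a * (T x n + R x n))"
    using x T R by (simp add: bounded_operator_def algebra_simps)
  assume y: "y \<in> ell2"
  show "(\<lambda>n. T (\<lambda>n. x n + y n) n + R (\<lambda>n. x n + y n) n) =
      (\<lambda>n. T x n + R x n + (T y n + R y n))"
    using x y T R by (simp add: bounded_operator_def algebra_simps)
next
  obtain C D where C: "\<And>x. x \<in> ell2 \<Longrightarrow> ell2_norm (T x) \<le> C * ell2_norm x"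
    and D: "\<And>x. x \<in> ell2 \<Longrightarrow> ell2_norm (R x) \<le> D * ell2_norm x"
    using T R unfolding bounded_operator_def by metis
  \<comment> \<open>The sign of C is unknown here; squaring is monotone because the left side of the
    inequality is nonnegative.\<close>
  have sq: "(\<Sum>n. (cmod (y n))\<^sup>2) \<le> C\<^sup>2 * (\<Sum>n. (cmod (x n))\<^sup>2)"
    if "ell2_norm y \<le> C * ell2_norm x" "x \<in> ell2" "y \<in> ell2" for x y C
  proof -
    have nn: "(\<Sum>n. (cmod (x n))\<^sup>2) \<ge> 0" "(\<Sum>n. (cmod (y n))\<^sup>2) \<ge> 0"
      using that by (auto simp: ell2_def intro: suminf_nonneg)
    have "(ell2_norm y)\<^sup>2 \<le> (C * ell2_norm x)\<^sup>2"
      using that nn by (intro power_mono) (auto simp: ell2_norm_def)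
    then show ?thesis
      using nn by (simp add: ell2_norm_def power_mult_distrib)
  qed
  show "\<exists>C. \<forall>x\<in>ell2. ell2_norm (\<lambda>n. T x n + R x n) \<le> C * ell2_norm x"
  proof (intro exI ballI)
    fix x
    assume x: "x \<in> ell2"
    have Tx: "T x \<in> ell2" and Rx: "R x \<in> ell2"
      using T R x by (auto simp: bounded_operator_def)
    have s: "summable (\<lambda>n. 2 * ((cmod (T x n))\<^sup>2 + (cmod (R x n))\<^sup>2))"
      using Tx Rx by (intro summable_mult summable_add) (auto simp: ell2_def)
    have "(\<Sum>n. (cmod (T x n + R x n))\<^sup>2) \<le> (\<Sum>n. 2 * ((cmod (T x n))\<^sup>2 + (cmod (R x n))\<^sup>2))"
      using ell2_add[OF Tx Rx] s by (intro suminf_le norm_add_sq_le) (simp_all add: ell2_def)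
    also have "\<dots> = 2 * ((\<Sum>n. (cmod (T x n))\<^sup>2) + (\<Sum>n. (cmod (R x n))\<^sup>2))"
      using Tx Rx by (subst suminf_mult) (auto simp: ell2_def suminf_add intro: summable_add)
    also have "\<dots> \<le> 2 * (C\<^sup>2 * (\<Sum>n. (cmod (x n))\<^sup>2) + D\<^sup>2 * (\<Sum>n. (cmod (x n))\<^sup>2))"
      using sq[OF C[OF x] x Tx] sq[OF D[OF x] x Rx] by simp
    also have "\<dots> = (2 * (C\<^sup>2 + D\<^sup>2)) * (\<Sum>n. (cmod (x n))\<^sup>2)"
      by (simp add: algebra_simps)
    finally show "ell2_norm (\<lambda>n. T x n + R x n) \<le> sqrt (2 * (C\<^sup>2 + D\<^sup>2)) * ell2_norm x"
      unfolding ell2_norm_def real_sqrt_mult[symmetric] by (rule real_sqrt_le_mono)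
  qed
qed

lemma raise_lower_adjoint:
  assumes "x \<in> ell2" "y \<in> ell2" "\<And>n. cmod (a n) \<le> C"
  shows "ell2_inner (raise a d x) y = ell2_inner x (lower (\<lambda>n. cnj (a n)) d y)"
proof -
  have "raise a d x \<in> ell2"
    using raise_bounded[OF assms(3)] assms(1) by (simp add: bounded_operator_def)
  then have "(\<lambda>n. raise a d x n * cnj (y n)) sums ell2_inner (raise a d x) y"
    unfolding ell2_inner_def by (intro summable_sums ell2_product_summable assms)
  then have "(\<lambda>n. x n * cnj (lower (\<lambda>n. cnj (a n)) d y n)) sums ell2_inner (raise a d x) y"
    by (subst (asm) sums_raise_shift[of d]) (simp_all add: raise_def lower_def mult_ac)
  then show ?thesis
    by (simp add: ell2_inner_def sums_iff)
qed

text \<open>\<open>d n\<close> is the leading minor of size n of the Hermitian matrix of the form,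
  so the quotients of consecutive values are its pivots.\<close>

lemma tridiag_form_nonneg:
  fixes d D :: "nat \<Rightarrow> real" and b y :: "nat \<Rightarrow> complex"
  assumes pos: "\<And>n. d n > 0" and d0: "d 0 = 1" and d1: "d 1 = D 0"
    and rec: "\<And>n. d (Suc (Suc n)) = D (Suc n) * d (Suc n) - (cmod (b n))\<^sup>2 * d n"
  shows "(\<Sum>n\<le>N. D n * (cmod (y n))\<^sup>2) + (\<Sum>n<N. 2 * Re (b n * y n * cnj (y (Suc n)))) \<ge> 0"
proof -
  text \<open>Completing squares leaves the last pivot of the Cholesky decomposition.\<close>
  have "(\<Sum>n\<le>N. D n * (cmod (y n))\<^sup>2) + (\<Sum>n<N. 2 * Re (b n * y n * cnj (y (Suc n))))
      \<ge> d (Suc N) / d N * (cmod (y N))\<^sup>2"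
  proof (induction N)
    case 0
    show ?case using d0 d1 by simp
  next
    case (Suc N)
    define p where "p = d (Suc N) / d N"
    have p: "p > 0" using pos by (simp add: p_def)
    have piv: "d (Suc (Suc N)) / d (Suc N) = D (Suc N) - (cmod (b N))\<^sup>2 / p"
      using pos[of N] pos[of "Suc N"] by (simp add: rec p_def field_simps)
    have "\<bar>Re (b N * y N * cnj (y (Suc N)))\<bar> \<le> cmod (b N) * cmod (y N) * cmod (y (Suc N))"
      using abs_Re_le_cmod[of "b N * y N * cnj (y (Suc N))"] by (simp add: norm_mult)
    moreover have "p * (cmod (y N))\<^sup>2 - 2 * (cmod (b N) * cmod (y N) * cmod (y (Suc N)))
        + (cmod (b N))\<^sup>2 / p * (cmod (y (Suc N)))\<^sup>2 =
        p * (cmod (y N) - cmod (b N) / p * cmod (y (Suc N)))\<^sup>2"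
      using p by (simp add: field_simps power2_eq_square)
    moreover have "p * (cmod (y N) - cmod (b N) / p * cmod (y (Suc N)))\<^sup>2 \<ge> 0"
      using p by simp
    ultimately have "p * (cmod (y N))\<^sup>2 + D (Suc N) * (cmod (y (Suc N)))\<^sup>2
        + 2 * Re (b N * y N * cnj (y (Suc N)))
        \<ge> d (Suc (Suc N)) / d (Suc N) * (cmod (y (Suc N)))\<^sup>2"
      unfolding piv left_diff_distrib by linarith
    then show ?case
      using Suc unfolding p_def by simp
  qed
  moreover have "d (Suc N) / d N * (cmod (y N))\<^sup>2 \<ge> 0"
    using pos[of N] pos[of "Suc N"] by simp
  ultimately show ?thesis by linarith
qed

section \<open>The self-commutator as a quadratic form\<close>

lemma cmod_add_sq: "(cmod (a + b))\<^sup>2 = (cmod a)\<^sup>2 + (cmod b)\<^sup>2 + 2 * Re (a * cnj b)"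
  unfolding cmod_power2 by (simp add: power2_eq_square algebra_simps)


lemma Re_cnj_swap: "Re (a * cnj b) = Re (b * cnj a)"
  by (simp add: mult.commute)

lemma norm_add_sums:
  assumes "f \<in> ell2" "g \<in> ell2"
  shows "(\<lambda>n. (cmod (f n))\<^sup>2) sums (\<Sum>n. (cmod (f n))\<^sup>2)"
    and "(\<lambda>n. 2 * Re (f n * cnj (g n))) sums (\<Sum>n. 2 * Re (f n * cnj (g n)))"
    and "(\<Sum>n. (cmod (f n + g n))\<^sup>2) =
      (\<Sum>n. (cmod (f n))\<^sup>2) + (\<Sum>n. (cmod (g n))\<^sup>2) + (\<Sum>n. 2 * Re (f n * cnj (g n)))"
proof -
  have sums: "(\<lambda>n. (cmod (f n))\<^sup>2) sums (\<Sum>n. (cmod (f n))\<^sup>2)" if "f \<in> ell2" for f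
    using that by (intro summable_sums) (simp add: ell2_def)
  then show "(\<lambda>n. (cmod (f n))\<^sup>2) sums (\<Sum>n. (cmod (f n))\<^sup>2)"
    using assms by blast
  show cross: "(\<lambda>n. 2 * Re (f n * cnj (g n))) sums (\<Sum>n. 2 * Re (f n * cnj (g n)))"
    using ell2_product_summable[OF assms] by (intro summable_sums summable_mult summable_Re)
  have "(\<lambda>n. (cmod (f n))\<^sup>2 + (cmod (g n))\<^sup>2 + 2 * Re (f n * cnj (g n))) sums
      ((\<Sum>n. (cmod (f n))\<^sup>2) + (\<Sum>n. (cmod (g n))\<^sup>2) + (\<Sum>n. 2 * Re (f n * cnj (g n))))"
    using sums assms cross by (intro sums_add) auto
  then show "(\<Sum>n. (cmod (f n + g n))\<^sup>2) =
      (\<Sum>n. (cmod (f n))\<^sup>2) + (\<Sum>n. (cmod (g n))\<^sup>2) + (\<Sum>n. 2 * Re (f n * cnj (g n)))"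
    by (simp add: cmod_add_sq sums_iff)
qed

text \<open>The signed square root of \<open>w_seq\<close>: times s, it is the coupling between
  coordinates k and k + 2. Only its modulus enters the minors.\<close>

definition shift_cross :: "(nat \<Rightarrow> real) \<Rightarrow> nat \<Rightarrow> real" where
  "shift_cross \<alpha> k = \<alpha> k * \<alpha> (k + 1) * ((\<alpha> (k + 2))\<^sup>2 - (zero_ext \<alpha> (int k - 1))\<^sup>2)"

lemma shift_cross_sq: "(shift_cross \<alpha> k)\<^sup>2 = w_seq \<alpha> k"
  by (simp add: shift_cross_def w_seq_def zero_ext_def nat_add_distrib power_mult_distrib)

context
  fixes \<alpha> :: "nat \<Rightarrow> real" and s :: complex and C :: real
  assumes \<alpha>_bound: "\<And>n. \<bar>\<alpha> n\<bar> \<le> C"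
begin

definition a1 :: "nat \<Rightarrow> complex" where
  "a1 n = complex_of_real (\<alpha> n)"

definition a3 :: "nat \<Rightarrow> complex" where
  "a3 n = s * complex_of_real (\<alpha> n * \<alpha> (n + 1) * \<alpha> (n + 2))"

definition cubic_op :: "(nat \<Rightarrow> complex) \<Rightarrow> nat \<Rightarrow> complex" where
  "cubic_op x n = raise a1 1 x n + raise a3 3 x n"

definition cubic_adj :: "(nat \<Rightarrow> complex) \<Rightarrow> nat \<Rightarrow> complex" where
  "cubic_adj x n = lower (\<lambda>n. cnj (a1 n)) 1 x n + lower (\<lambda>n. cnj (a3 n)) 3 x n"

lemma cubic_op_eq: "(\<lambda>x n. weighted_shift \<alpha> x n + s * (weighted_shift \<alpha> ^^ 3) x n) = cubic_op"
proof (intro ext)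
  fix x and n :: nat
  consider "n = 0" | "n = 1" | "n = 2" | k where "n = Suc (Suc (Suc k))"
    by (metis One_nat_def not0_implies_Suc numeral_2_eq_2)
  then show "weighted_shift \<alpha> x n + s * (weighted_shift \<alpha> ^^ 3) x n = cubic_op x n"
    by cases (simp_all add: cubic_op_def raise_def weighted_shift_def a1_def a3_def eval_nat_numeral)
qed

lemma a1_bound: "cmod (a1 n) \<le> C"
  using \<alpha>_bound by (simp add: a1_def)

lemma a3_bound: "cmod (a3 n) \<le> cmod s * (C * C * C)"
proof -
  have "\<bar>\<alpha> n\<bar> * \<bar>\<alpha> (n + 1)\<bar> * \<bar>\<alpha> (n + 2)\<bar> \<le> C * C * C"
    using \<alpha>_bound order_trans[OF abs_ge_zero \<alpha>_bound] by (intro mult_mono) auto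
  then show ?thesis
    unfolding a3_def norm_mult norm_of_real abs_mult by (intro mult_left_mono) auto
qed

lemma cubic_op_bounded: "bounded_operator cubic_op"
  unfolding cubic_op_def[abs_def]
  by (rule bounded_operator_add[OF raise_bounded[OF a1_bound] raise_bounded[OF a3_bound]])

lemma cubic_adj_bounded: "bounded_operator cubic_adj"
  unfolding cubic_adj_def[abs_def]
  by (rule bounded_operator_add[OF lower_bounded[where C = C] lower_bounded[where C = "cmod s * (C * C * C)"]])
    (simp_all add: a1_bound a3_bound)

lemma cubic_op_adjoint:
  assumes "x \<in> ell2" "y \<in> ell2"
  shows "ell2_inner (cubic_op x) y = ell2_inner x (cubic_adj y)"
proof -
  have r: "raise a1 1 x \<in> ell2" "raise a3 3 x \<in> ell2"
    using raise_bounded[OF a1_bound] raise_bounded[OF a3_bound] assms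
    by (auto simp: bounded_operator_def)
  have l: "lower (\<lambda>n. cnj (a1 n)) 1 y \<in> ell2" "lower (\<lambda>n. cnj (a3 n)) 3 y \<in> ell2"
    using lower_bounded[of "\<lambda>n. cnj (a1 n)" C 1]
      lower_bounded[of "\<lambda>n. cnj (a3 n)" "cmod s * (C * C * C)" 3] a1_bound a3_bound assms
    by (auto simp: bounded_operator_def)
  have "ell2_inner (cubic_op x) y = ell2_inner (raise a1 1 x) y + ell2_inner (raise a3 3 x) y"
    using suminf_add[OF ell2_product_summable[OF r(1) assms(2)] ell2_product_summable[OF r(2) assms(2)]]
    by (simp add: ell2_inner_def cubic_op_def distrib_right)
  also have "ell2_inner (raise a1 1 x) y = ell2_inner x (lower (\<lambda>n. cnj (a1 n)) 1 y)"
    by (rule raise_lower_adjoint[OF assms a1_bound])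
  also have "ell2_inner (raise a3 3 x) y = ell2_inner x (lower (\<lambda>n. cnj (a3 n)) 3 y)"
    by (rule raise_lower_adjoint[OF assms a3_bound])
  also have "ell2_inner x (lower (\<lambda>n. cnj (a1 n)) 1 y) + ell2_inner x (lower (\<lambda>n. cnj (a3 n)) 3 y) =
      ell2_inner x (cubic_adj y)"
    using suminf_add[OF ell2_product_summable[OF assms(1) l(1)] ell2_product_summable[OF assms(1) l(2)]]
    by (simp add: ell2_inner_def cubic_adj_def distrib_left)
  finally show ?thesis .
qed

text \<open>The squared norms are expanded into pure and mixed terms. The shifts by 1 and 3 differ
  by 2, so mixed terms link only k and k + 2; this is what separates even from odd indices.\<close>

lemma cubic_defect:
  assumes x: "x \<in> ell2"
  obtains d e where
    "(\<lambda>k. (u_seq \<alpha> k + v_seq \<alpha> k * (cmod s)\<^sup>2) * (cmod (x k))\<^sup>2) sums d"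
    "(\<lambda>k. 2 * Re (s * complex_of_real (shift_cross \<alpha> k) * x k * cnj (x (k + 2)))) sums e"
    "(\<Sum>n. (cmod (cubic_op x n))\<^sup>2) - (\<Sum>n. (cmod (cubic_adj x n))\<^sup>2) = d + e"
proof -
  define r1 where "r1 = raise a1 1 x"
  define r3 where "r3 = raise a3 3 x"
  define l1 where "l1 = lower (\<lambda>n. cnj (a1 n)) 1 x"
  define l3 where "l3 = lower (\<lambda>n. cnj (a3 n)) 3 x"
  have r: "r1 \<in> ell2" "r3 \<in> ell2"
    using raise_bounded[OF a1_bound] raise_bounded[OF a3_bound] x
    by (auto simp: bounded_operator_def r1_def r3_def)
  have l: "l1 \<in> ell2" "l3 \<in> ell2"
    using lower_bounded[of "\<lambda>n. cnj (a1 n)" C 1]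
      lower_bounded[of "\<lambda>n. cnj (a3 n)" "cmod s * (C * C * C)" 3] a1_bound a3_bound x
    by (auto simp: bounded_operator_def l1_def l3_def)
  \<comment> \<open>The weights just before position k, extended by zero. With them the sums coming
    from \<open>lower\<close> also start at index 0 and can be subtracted termwise from those coming
    from \<open>raise\<close>.\<close>
  define z where "z k = zero_ext \<alpha> (int k - 1)" for k
  define z3 where "z3 k = zero_ext \<alpha> (int k - 3) * zero_ext \<alpha> (int k - 2) * zero_ext \<alpha> (int k - 1)" for k
  have z: "z 0 = 0" "z (Suc k) = \<alpha> k" for k
    by (simp_all add: z_def zero_ext_def)
  have z3: "z3 k = (if k < 3 then 0 else \<alpha> (k - 3) * \<alpha> (k - 2) * \<alpha> (k - 1))" for k
    by (auto simp: z3_def zero_ext_def nat_diff_distrib)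
  have R1: "(\<lambda>n. (\<alpha> n)\<^sup>2 * (cmod (x n))\<^sup>2) sums (\<Sum>n. (cmod (r1 n))\<^sup>2)"
    using norm_add_sums(1)[OF r(1) r(2)]
    by (subst (asm) sums_raise_shift[of 1])
      (simp_all add: r1_def raise_def a1_def norm_mult power_mult_distrib)
  have R3: "(\<lambda>n. (cmod s)\<^sup>2 * (\<alpha> n * \<alpha> (n + 1) * \<alpha> (n + 2))\<^sup>2 * (cmod (x n))\<^sup>2) sums
      (\<Sum>n. (cmod (r3 n))\<^sup>2)"
    using norm_add_sums(1)[OF r(2) r(1)]
    by (subst (asm) sums_raise_shift[of 3])
      (simp_all add: r3_def raise_def a3_def norm_mult power_mult_distrib mult_ac)
  have R13: "(\<lambda>n. 2 * Re (s * complex_of_real (\<alpha> n * \<alpha> (n + 1) * (\<alpha> (n + 2))\<^sup>2) * x n * cnj (x (n + 2)))) sums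
      (\<Sum>n. 2 * Re (r1 n * cnj (r3 n)))"
  proof -
    have "(\<lambda>n. 2 * Re (r1 (n + 3) * cnj (r3 (n + 3)))) sums (\<Sum>n. 2 * Re (r1 n * cnj (r3 n)))"
      using norm_add_sums(2)[OF r] by (subst (asm) sums_raise_shift[of 3]) (simp_all add: r3_def raise_def)
    moreover have "Re (r1 (n + 3) * cnj (r3 (n + 3))) =
        Re (s * complex_of_real (\<alpha> n * \<alpha> (n + 1) * (\<alpha> (n + 2))\<^sup>2) * x n * cnj (x (n + 2)))" for n
    proof -
      \<comment> \<open>Taking the conjugate of the mixed product puts s instead of its conjugate in
        front, as in \<open>L13\<close>, and keeps the real part.\<close>
      have "r3 (n + 3) * cnj (r1 (n + 3)) =
          s * complex_of_real (\<alpha> n * \<alpha> (n + 1) * (\<alpha> (n + 2))\<^sup>2) * x n * cnj (x (n + 2))"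
        by (simp add: r1_def r3_def raise_def a1_def a3_def power2_eq_square mult_ac eval_nat_numeral)
      then show ?thesis using Re_cnj_swap by metis
    qed
    ultimately show ?thesis by (simp only:)
  qed
  have L1: "(\<lambda>n. (z n)\<^sup>2 * (cmod (x n))\<^sup>2) sums (\<Sum>n. (cmod (l1 n))\<^sup>2)"
    using norm_add_sums(1)[OF l(1) l(2)]
    by (subst sums_raise_shift[of 1])
      (simp_all add: z l1_def lower_def a1_def norm_mult power_mult_distrib)
  have L3: "(\<lambda>n. (cmod s)\<^sup>2 * (z3 n)\<^sup>2 * (cmod (x n))\<^sup>2) sums (\<Sum>n. (cmod (l3 n))\<^sup>2)"
    using norm_add_sums(1)[OF l(2) l(1)]
    by (subst sums_raise_shift[of 3])
      (simp_all add: z3 l3_def lower_def a3_def norm_mult power_mult_distrib mult_ac)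
  have L13: "(\<lambda>n. 2 * Re (s * complex_of_real (\<alpha> n * \<alpha> (n + 1) * (z n)\<^sup>2) * x n * cnj (x (n + 2)))) sums
      (\<Sum>n. 2 * Re (l1 n * cnj (l3 n)))"
  proof (subst sums_raise_shift[of 1])
    have "l1 n * cnj (l3 n) = s * complex_of_real (\<alpha> (n + 1) * \<alpha> (n + 1 + 1) * (z (n + 1))\<^sup>2) *
        x (n + 1) * cnj (x (n + 1 + 2))" for n
      by (simp add: l1_def l3_def lower_def a1_def a3_def z power2_eq_square mult_ac eval_nat_numeral)
    then show "(\<lambda>n. 2 * Re (s * complex_of_real (\<alpha> (n + 1) * \<alpha> (n + 1 + 1) * (z (n + 1))\<^sup>2) *
        x (n + 1) * cnj (x (n + 1 + 2)))) sums (\<Sum>n. 2 * Re (l1 n * cnj (l3 n)))"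
      using norm_add_sums(2)[OF l] by (simp only:)
  qed (simp add: z)
  have uu: "u_seq \<alpha> k = (\<alpha> k)\<^sup>2 - (z k)\<^sup>2" for k
    by (simp add: u_seq_def z_def zero_ext_def)
  have vv: "v_seq \<alpha> k = (\<alpha> k * \<alpha> (k + 1) * \<alpha> (k + 2))\<^sup>2 - (z3 k)\<^sup>2" for k
    by (simp add: v_seq_def z3_def zero_ext_def Let_def nat_add_distrib power_mult_distrib)
  have ww: "shift_cross \<alpha> k = \<alpha> k * \<alpha> (k + 1) * (\<alpha> (k + 2))\<^sup>2 - \<alpha> k * \<alpha> (k + 1) * (z k)\<^sup>2" for k
    by (simp add: shift_cross_def z_def algebra_simps)
  show thesis
  proof
    show "(\<lambda>k. (u_seq \<alpha> k + v_seq \<alpha> k * (cmod s)\<^sup>2) * (cmod (x k))\<^sup>2) sums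
        ((\<Sum>n. (cmod (r1 n))\<^sup>2) + (\<Sum>n. (cmod (r3 n))\<^sup>2) - ((\<Sum>n. (cmod (l1 n))\<^sup>2) + (\<Sum>n. (cmod (l3 n))\<^sup>2)))"
      using sums_diff[OF sums_add[OF R1 R3] sums_add[OF L1 L3]]
      by (simp add: uu vv algebra_simps)
    show "(\<lambda>k. 2 * Re (s * complex_of_real (shift_cross \<alpha> k) * x k * cnj (x (k + 2)))) sums
        ((\<Sum>n. 2 * Re (r1 n * cnj (r3 n))) - (\<Sum>n. 2 * Re (l1 n * cnj (l3 n))))"
      using sums_diff[OF R13 L13]
      unfolding ww of_real_diff by (simp only: right_diff_distrib left_diff_distrib minus_complex.simps)
    have "cubic_op x n = r1 n + r3 n" "cubic_adj x n = l1 n + l3 n" for n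
      by (simp_all add: cubic_op_def cubic_adj_def r1_def r3_def l1_def l3_def)
    then show "(\<Sum>n. (cmod (cubic_op x n))\<^sup>2) - (\<Sum>n. (cmod (cubic_adj x n))\<^sup>2) =
        (\<Sum>n. (cmod (r1 n))\<^sup>2) + (\<Sum>n. (cmod (r3 n))\<^sup>2) - ((\<Sum>n. (cmod (l1 n))\<^sup>2) + (\<Sum>n. (cmod (l3 n))\<^sup>2)) +
        ((\<Sum>n. 2 * Re (r1 n * cnj (r3 n))) - (\<Sum>n. 2 * Re (l1 n * cnj (l3 n))))"
      using norm_add_sums(3)[OF r] norm_add_sums(3)[OF l] by simp
  qed
qed

end

lemma sum_even_odd:
  fixes f :: "nat \<Rightarrow> 'a::comm_monoid_add"
  shows "(\<Sum>k<2 * N. f k) = (\<Sum>n<N. f (2 * n)) + (\<Sum>n<N. f (2 * n + 1))"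
  by (induction N) (simp_all add: add_ac)

text \<open>The defect is a limit of truncations, each splitting by parity into two finite
  tridiagonal forms with t = |s|^2. Thus no infinite matrix has to be treated.\<close>

lemma semi_cubically_hyponormalI:
  assumes bound: "\<And>n. \<bar>\<alpha> n\<bar> \<le> C" and u: "\<And>k. u_seq \<alpha> k \<ge> 0"
    and form: "\<And>j t b N y. j \<in> {1, 2} \<Longrightarrow> t > 0 \<Longrightarrow> (\<And>n. (cmod (b n))\<^sup>2 = w_br \<alpha> j n * t) \<Longrightarrow>
      (\<Sum>n\<le>N. (u_br \<alpha> j n + v_br \<alpha> j n * t) * (cmod (y n))\<^sup>2)
      + (\<Sum>n<N. 2 * Re (b n * y n * cnj (y (Suc n)))) \<ge> 0"
  shows "semi_cubically_hyponormal (weighted_shift \<alpha>)"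
  unfolding semi_cubically_hyponormal_def
proof
  fix s :: complex
  show "hyponormal (\<lambda>x n. weighted_shift \<alpha> x n + s * (weighted_shift \<alpha> ^^ 3) x n)"
    unfolding cubic_op_eq[OF bound]
  proof (rule hyponormalI[OF cubic_op_bounded[OF bound] cubic_adj_bounded[OF bound]
        cubic_op_adjoint[OF bound]])
    fix x
    assume x: "x \<in> ell2"
    let ?t = "(cmod s)\<^sup>2"
    let ?D = "\<lambda>k. (u_seq \<alpha> k + v_seq \<alpha> k * ?t) * (cmod (x k))\<^sup>2"
    let ?b = "\<lambda>k. s * complex_of_real (shift_cross \<alpha> k)"
    let ?E = "\<lambda>k. 2 * Re (?b k * x k * cnj (x (k + 2)))"
    obtain d e where d: "?D sums d" and e: "?E sums e"
      and de: "(\<Sum>n. (cmod (cubic_op \<alpha> s x n))\<^sup>2) - (\<Sum>n. (cmod (cubic_adj \<alpha> s x n))\<^sup>2) = d + e"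
      by (rule cubic_defect[OF bound x, where s = s])
    \<comment> \<open>The diagonal is cut at 2N + 2 and the couplings at 2N, so every coupling has
      both ends inside and each parity class gives a block with rows 0 to N.\<close>
    have "(\<lambda>N. \<Sum>k<2 * Suc N. ?D k) \<longlonglongrightarrow> d"
      using d unfolding sums_def by (rule filterlim_compose) (intro filterlim_subseq strict_monoI, simp)
    moreover have "(\<lambda>N. \<Sum>k<2 * N. ?E k) \<longlonglongrightarrow> e"
      using e unfolding sums_def by (rule filterlim_compose) (intro filterlim_subseq strict_monoI, simp)
    ultimately have lim: "(\<lambda>N. (\<Sum>k<2 * Suc N. ?D k) + (\<Sum>k<2 * N. ?E k)) \<longlonglongrightarrow> d + e"
      by (rule tendsto_add)
    have "(\<Sum>k<2 * Suc N. ?D k) + (\<Sum>k<2 * N. ?E k) \<ge> 0" for N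
    proof (cases "s = 0")
      \<comment> \<open>At t = 0 the minors are products of the u's and can vanish, so positivity is
        read off the diagonal directly.\<close>
      case True
      then show ?thesis by (simp add: u sum_nonneg del: sum.lessThan_Suc)
    next
      case False
      then have t: "?t > 0" by simp
      have b: "(cmod (?b k))\<^sup>2 = w_seq \<alpha> k * ?t" for k
        by (simp add: norm_mult power_mult_distrib shift_cross_sq)
      have "(\<Sum>n\<le>N. ?D (2 * n)) + (\<Sum>n<N. ?E (2 * n)) \<ge> 0"
        using form[where j = 1 and t = ?t and b = "\<lambda>n. ?b (2 * n)" and y = "\<lambda>n. x (2 * n)" and N = N] t b by (simp add: branch_def)
      moreover have "(\<Sum>n\<le>N. ?D (2 * n + 1)) + (\<Sum>n<N. ?E (2 * n + 1)) \<ge> 0"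
        using form[where j = 2 and t = ?t and b = "\<lambda>n. ?b (2 * n + 1)" and y = "\<lambda>n. x (2 * n + 1)" and N = N] t b by (simp add: branch_def)
      ultimately show ?thesis
        unfolding sum_even_odd lessThan_Suc_atMost by linarith
    qed
    then have "d + e \<ge> 0"
      by (intro LIMSEQ_le_const[OF lim]) blast
    with de show "(\<Sum>n. (cmod (cubic_adj \<alpha> s x n))\<^sup>2) \<le> (\<Sum>n. (cmod (cubic_op \<alpha> s x n))\<^sup>2)"
      by linarith
  qed
qed


section \<open>The Stampfli tail\<close>

text \<open>Partial products g linearize the recursion, with a (n + k) = g (k + 1) / g k; after
  clearing denominators only polynomial identities in x, S, P remain. For squared weights the claims
  say: u times a shifted v is w; the ratio v/u is a constant times a product of two consecutive
  squared weights; and such products obey a recursion of the same shape.\<close>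

lemma linear_recurrence_quotients:
  fixes a :: "nat \<Rightarrow> real" and S P :: real
  assumes pos: "\<And>n. a n > 0" and rec: "\<And>n. a (Suc n) * a n = S * a n - P"
  shows "(a (n + 1) - a n) * (a (n + 3) * a (n + 4) * a (n + 5) - a n * a (n + 1) * a (n + 2)) =
      a (n + 1) * a (n + 2) * (a (n + 3) - a n)\<^sup>2"
    and "P\<^sup>2 * (a (n + 3) * a (n + 4) * a (n + 5) - a n * a (n + 1) * a (n + 2)) =
      (S\<^sup>2 - P)\<^sup>2 * (a n * a (n + 1)) * (a (n + 3) - a (n + 2))"
    and "a n * a (n + 1) * (a (n + 2) * a (n + 3)) = (S\<^sup>2 - 2 * P) * (a n * a (n + 1)) - P\<^sup>2"
proof -
  define g :: "nat \<Rightarrow> real" where "g k = (\<Prod>r<k. a (n + r))" for k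
  have g_pos: "g k > 0" for k
    unfolding g_def by (intro prod_pos) (simp add: pos)
  have g_Suc: "g (Suc k) = g k * a (n + k)" for k
    by (simp add: g_def)
  have g_rec: "g (Suc (Suc k)) = S * g (Suc k) - P * g k" for k
  proof -
    have "g (Suc (Suc k)) = g k * (a (Suc (n + k)) * a (n + k))"
      by (simp add: g_Suc)
    then show ?thesis
      unfolding rec by (simp add: g_Suc algebra_simps)
  qed
  have a: "a (n + k) = g (Suc k) / g k" for k
    using g_pos[of k] by (simp add: g_Suc)
  have g0: "g 0 = 1" by (simp add: g_def)
  define x where "x = g 1"
  have g1: "g 1 = x" and g2: "g 2 = S * x - P" and g3: "g 3 = S * g 2 - P * x"
    and g4: "g 4 = S * g 3 - P * g 2" and g5: "g 5 = S * g 4 - P * g 3"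
    and g6: "g 6 = S * g 5 - P * g 4"
    using g_rec[of 0] g_rec[of 1] g_rec[of 2] g_rec[of 3] g_rec[of 4] g0
    by (simp_all add: x_def eval_nat_numeral)
  have p: "x > 0" "g 2 > 0" "g 3 > 0" "g 4 > 0" "g 5 > 0"
    using g_pos unfolding x_def by auto
  have a0: "a n = x" and a1: "a (n + 1) = g 2 / x" and a2: "a (n + 2) = g 3 / g 2"
    and a3: "a (n + 3) = g 4 / g 3" and a4: "a (n + 4) = g 5 / g 4" and a5: "a (n + 5) = g 6 / g 5"
    using a[of 0] a[of 1] a[of 2] a[of 3] a[of 4] a[of 5] g0 g1
    by (simp_all add: eval_nat_numeral)
  have e345: "a (n + 3) * a (n + 4) * a (n + 5) = g 6 / g 3"
    and e012: "a n * a (n + 1) * a (n + 2) = g 3" and e12: "a (n + 1) * a (n + 2) = g 3 / x"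
    and e01: "a n * a (n + 1) = g 2" and e23: "a (n + 2) * a (n + 3) = g 4 / g 2"
    unfolding a0 a1 a2 a3 a4 a5 using p by simp_all
  \<comment> \<open>This is g 0 * g 2 - (g 1)^2, a Casorati determinant, equal to a n * (a (n + 1) -
    a n). It divides all differences below; \<open>i3\<close> is its scaling by P at each of two
    steps.\<close>
  define \<Delta> where "\<Delta> = g 2 - x\<^sup>2"
  have i1: "g 6 - (g 3)\<^sup>2 = \<Delta> * (S\<^sup>2 - P)\<^sup>2"
    unfolding \<Delta>_def g6 g5 g4 g3 g2 by (simp add: algebra_simps power2_eq_square)
  have i2: "g 4 - x * g 3 = \<Delta> * (S\<^sup>2 - P)"
    unfolding \<Delta>_def g4 g3 g2 by (simp add: algebra_simps power2_eq_square)
  have i3: "g 4 * g 2 - (g 3)\<^sup>2 = P\<^sup>2 * \<Delta>"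
    unfolding \<Delta>_def g4 g3 g2 by (simp add: algebra_simps power2_eq_square)
  have i4: "g 4 = (S\<^sup>2 - 2 * P) * g 2 - P\<^sup>2"
    unfolding g4 g3 g2 by (simp add: algebra_simps power2_eq_square)
  have v: "g 6 / g 3 - g 3 = \<Delta> * (S\<^sup>2 - P)\<^sup>2 / g 3"
    using p i1 by (simp add: field_simps power2_eq_square)
  have u: "g 2 / x - x = \<Delta> / x"
    using p by (simp add: \<Delta>_def field_simps power2_eq_square)
  have w: "g 4 / g 3 - x = \<Delta> * (S\<^sup>2 - P) / g 3"
    using p i2 by (simp add: field_simps)
  have u': "g 4 / g 3 - g 3 / g 2 = P\<^sup>2 * \<Delta> / (g 3 * g 2)"
    using p i3 by (simp add: field_simps power2_eq_square)
  show "(a (n + 1) - a n) * (a (n + 3) * a (n + 4) * a (n + 5) - a n * a (n + 1) * a (n + 2)) =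
      a (n + 1) * a (n + 2) * (a (n + 3) - a n)\<^sup>2"
    unfolding e345 e012 e12 unfolding a0 a1 a3 u v w
    using p by (simp add: field_simps power2_eq_square)
  show "P\<^sup>2 * (a (n + 3) * a (n + 4) * a (n + 5) - a n * a (n + 1) * a (n + 2)) =
      (S\<^sup>2 - P)\<^sup>2 * (a n * a (n + 1)) * (a (n + 3) - a (n + 2))"
    unfolding e345 e012 unfolding e01 a3 a2 u' v
    using p by (simp add: field_simps power2_eq_square)
  show "a n * a (n + 1) * (a (n + 2) * a (n + 3)) = (S\<^sup>2 - 2 * P) * (a n * a (n + 1)) - P\<^sup>2"
    unfolding e01 e23 using p i4 by simp
qed

section \<open>Monotonicity and limit of the Stampfli weights\<close>

context
  fixes u v w :: real
  assumes u: "0 < u" and uv: "u < v" and vw: "v < w"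
begin

lemma Psi0_neg: "Psi0 u v w < 0"
  using u uv vw by (simp add: Psi0_def)

lemma Psi_u: "Psi1 u v w + Psi0 u v w / u = v"
  using u uv by (simp add: Psi0_def Psi1_def divide_simps) (simp add: algebra_simps)

lemma Psi_v: "Psi1 u v w + Psi0 u v w / v = w"
  using u uv by (simp add: Psi0_def Psi1_def divide_simps) (simp add: algebra_simps)

text \<open>The recursion is stipulated from index 3 on, but \<open>Psi0\<close> and
  \<open>Psi1\<close> are chosen so that it also maps u to v and v to w. As \<open>Psi0\<close> is
  negative, the recursion map increases on positive numbers: growth propagates, and positivity lets
  squaring undo the square root.\<close>

lemma stampfli_sq:
  defines "b \<equiv> \<lambda>n. (stampfli u v w n)\<^sup>2"
  shows "b 0 = u" and "b n > 0" and "b n < b (Suc n)"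
    and "b (Suc n) = Psi1 u v w + Psi0 u v w / b n"
proof -
  show b0: "b 0 = u" using u by (simp add: b_def)
  have b1: "b 1 = v" and b2: "b 2 = w"
    using u uv vw by (simp_all add: b_def numeral_2_eq_2)
  have "b n > 0 \<and> b n < b (Suc n) \<and> b (Suc n) = Psi1 u v w + Psi0 u v w / b n"
  proof (induction n)
    case 0
    then show ?case using b0 b1 u uv Psi_u by simp
  next
    case (Suc n)
    then have bn: "b n > 0" "b n < b (Suc n)" "b (Suc n) = Psi1 u v w + Psi0 u v w / b n"
      by auto
    have "Psi0 u v w / b n < Psi0 u v w / b (Suc n)"
      using bn Psi0_neg by (intro divide_strict_left_mono_neg) auto
    then have less: "b (Suc n) < Psi1 u v w + Psi0 u v w / b (Suc n)"
      using bn(3) by linarith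
    have "b (Suc (Suc n)) = Psi1 u v w + Psi0 u v w / b (Suc n)"
    proof (cases n)
      case 0
      then show ?thesis using b1 b2 Psi_v by (simp add: numeral_2_eq_2)
    next
      case (Suc n')
      then have "b (Suc (Suc n)) = (sqrt (Psi1 u v w + Psi0 u v w / b (Suc n)))\<^sup>2"
        by (simp add: b_def)
      then show ?thesis using bn less by simp
    qed
    then show ?case using bn less by simp
  qed
  then show "b n > 0" and "b n < b (Suc n)" and "b (Suc n) = Psi1 u v w + Psi0 u v w / b n"
    by auto
qed

lemma stampfli_sq_mult:
  "(stampfli u v w (Suc n))\<^sup>2 * (stampfli u v w n)\<^sup>2 =
     Psi1 u v w * (stampfli u v w n)\<^sup>2 - (- Psi0 u v w)"
  using stampfli_sq(2,4)[of n] by (simp add: field_simps)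

lemma stampfli_sq_less: "(stampfli u v w n)\<^sup>2 < Psi1 u v w"
proof -
  have "Psi0 u v w / (stampfli u v w n)\<^sup>2 < 0"
    using stampfli_sq(2)[of n] Psi0_neg by (intro divide_neg_pos) auto
  then show ?thesis
    using stampfli_sq(3,4)[of n] by linarith
qed

text \<open>Growth below the bound \<open>Psi1\<close> gives convergence to a fixed point of the
  recursion; the starting value u decides which of the two roots it is.\<close>

lemma stampfli_sq_tendsto:
  "(\<lambda>n. (stampfli u v w n)\<^sup>2) \<longlonglongrightarrow> (stampfli_L u v w)\<^sup>2"
proof -
  define b where "b n = (stampfli u v w n)\<^sup>2" for n
  define S where "S = Psi1 u v w"
  define P where "P = - Psi0 u v w"
  have inc: "incseq b"
    unfolding b_def by (intro incseq_SucI less_imp_le stampfli_sq(3))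
  obtain l where l: "b \<longlonglongrightarrow> l" and b_le: "\<And>n. b n \<le> l"
    using incseq_convergent[OF inc, of S] stampfli_sq_less
    by (metis b_def S_def less_imp_le)
  have "(\<lambda>n. b (Suc n) * b n) \<longlonglongrightarrow> l * l"
    by (intro tendsto_mult l LIMSEQ_Suc)
  moreover have "(\<lambda>n. b (Suc n) * b n) \<longlonglongrightarrow> S * l - P"
    using l unfolding b_def[abs_def] S_def P_def stampfli_sq_mult
    by (intro tendsto_diff tendsto_mult tendsto_const)
  ultimately have root: "l * l = S * l - P"
    by (rule LIMSEQ_unique)
  have "u < l"
    using stampfli_sq(1) stampfli_sq(3)[of 0] b_le[of 1] by (simp add: b_def)
  have Pu: "P = u * (S - v)"
    using Psi_u u by (simp add: S_def P_def field_simps)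
  text \<open>The recursion polynomial is negative at \<open>u\<close>, so a root beyond \<open>u\<close> is the larger one.\<close>
  have "(l - u) * (S - l - u) = u * (u - v)"
    using root unfolding Pu by (simp add: algebra_simps)
  then have "(l - u) * (S - l - u) < 0"
    using u uv by (simp add: mult_pos_neg)
  then have "S - l - u < 0"
    using \<open>u < l\<close> by (simp add: mult_less_0_iff)
  then have "2 * l - S > 0"
    using \<open>u < l\<close> by linarith
  moreover have "(2 * l - S)\<^sup>2 = S\<^sup>2 + 4 * (- P)"
    using root by (simp add: algebra_simps power2_eq_square)
  ultimately have "sqrt (S\<^sup>2 + 4 * (- P)) = 2 * l - S"
    by (metis less_imp_le real_sqrt_abs abs_of_nonneg)
  then have "(stampfli_L u v w)\<^sup>2 = l"
    using \<open>u < l\<close> u unfolding stampfli_L_def S_def P_def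
    by (simp add: power_mult_distrib power_divide)
  with l show ?thesis by (simp add: b_def[abs_def])
qed

end


section \<open>The characterization\<close>

lemma poly_pos_of_coeffs:
  fixes p :: "real poly"
  assumes "\<And>i. coeff p i \<ge> 0" and "coeff p n > 0" and "t > 0"
  shows "poly p t > 0"
  unfolding poly_altdef
proof (rule sum_pos2[of _ n])
  show "n \<in> {..degree p}"
    using assms(2) by (simp add: le_degree)
qed (use assms in auto)

lemma semi_cubically_hyponormal_of_pos_det_coeffs:
  assumes bound: "\<And>n. \<bar>\<alpha> n\<bar> \<le> C" and u: "\<And>k. u_seq \<alpha> k \<ge> 0"
    and pdc: "\<And>j. j \<in> {1, 2} \<Longrightarrow> pos_det_coeffs \<alpha> j"
  shows "semi_cubically_hyponormal (weighted_shift \<alpha>)"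
proof (rule semi_cubically_hyponormalI[OF bound u])
  fix j N :: nat and t :: real and b y :: "nat \<Rightarrow> complex"
  assume j: "j \<in> {1, 2}" and t: "t > 0" and b: "\<And>n. (cmod (b n))\<^sup>2 = w_br \<alpha> j n * t"
  define P where "P = tridiag_poly (u_br \<alpha> j) (v_br \<alpha> j) (w_br \<alpha> j)"
  show "(\<Sum>n\<le>N. (u_br \<alpha> j n + v_br \<alpha> j n * t) * (cmod (y n))\<^sup>2)
      + (\<Sum>n<N. 2 * Re (b n * y n * cnj (y (Suc n)))) \<ge> 0"
  proof (rule tridiag_form_nonneg[of "\<lambda>n. poly (P n) t"])
    fix n
    have "poly (P (Suc k)) t > 0" for k
    proof (rule poly_pos_of_coeffs[OF _ _ t])
      have c: "coeff (P (Suc k)) i = c_coeff \<alpha> j k i" for i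
        by (simp add: c_coeff_eq tridiag_coeff_def P_def del: tridiag_poly.simps)
      show "coeff (P (Suc k)) (k + 1) > 0"
        using pdc[OF j] unfolding c pos_det_coeffs_def by blast
      fix i
      show "coeff (P (Suc k)) i \<ge> 0"
      proof (cases "i \<le> k + 1")
        case True
        then show ?thesis
          using pdc[OF j] unfolding c pos_det_coeffs_def by blast
      next
        case False
        then show ?thesis
          unfolding c c_coeff_eq by (simp add: tridiag_coeff_eq_0)
      qed
    qed
    then show "poly (P n) t > 0"
      by (cases n) (simp_all add: P_def del: tridiag_poly.simps(2,3))
    show "poly (P (Suc (Suc n))) t =
        (u_br \<alpha> j (Suc n) + v_br \<alpha> j (Suc n) * t) * poly (P (Suc n)) t - (cmod (b n))\<^sup>2 * poly (P n) t"
      unfolding P_def tridiag_poly.simps(3) by (simp add: b algebra_simps del: tridiag_poly.simps)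
  qed (simp_all add: P_def mult.commute)
qed

lemma seq_eqs:
  shows "u_seq \<alpha> 0 = (\<alpha> 0)\<^sup>2"
    and "u_seq \<alpha> (Suc k) = (\<alpha> (k + 1))\<^sup>2 - (\<alpha> k)\<^sup>2"
    and "v_seq \<alpha> (k + 3) = (\<alpha> (k + 3))\<^sup>2 * (\<alpha> (k + 4))\<^sup>2 * (\<alpha> (k + 5))\<^sup>2
      - (\<alpha> k)\<^sup>2 * (\<alpha> (k + 1))\<^sup>2 * (\<alpha> (k + 2))\<^sup>2"
    and "w_seq \<alpha> (Suc k) = (\<alpha> (k + 1))\<^sup>2 * (\<alpha> (k + 2))\<^sup>2 * ((\<alpha> (k + 3))\<^sup>2 - (\<alpha> k)\<^sup>2)\<^sup>2"
  by (simp_all add: u_seq_def v_seq_def w_seq_def zero_ext_def Let_def nat_add_distrib eval_nat_numeral)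

text \<open>\<open>M\<close> is the constant relating a ratio v/u to the product of the squared
  weights three and two places earlier. Scaling the recursion of these products by \<open>M\<close>
  produces the constants A and B of the locale, and their limit l^2 the third parameter.\<close>

lemma tridiag_tail_branch:
  fixes \<alpha> :: "nat \<Rightarrow> real" and m j :: nat and S P l :: real
  assumes pos: "\<And>n. (\<alpha> n)\<^sup>2 > 0"
    and mono: "\<And>n. (\<alpha> n)\<^sup>2 \<le> (\<alpha> (Suc n))\<^sup>2"
    and strict: "\<And>n. n \<ge> m \<Longrightarrow> (\<alpha> n)\<^sup>2 < (\<alpha> (Suc n))\<^sup>2"
    and rec: "\<And>n. n \<ge> m \<Longrightarrow> (\<alpha> (Suc n))\<^sup>2 * (\<alpha> n)\<^sup>2 = S * (\<alpha> n)\<^sup>2 - P"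
    and P: "P > 0" and SP: "S\<^sup>2 \<noteq> P"
    and lim: "(\<lambda>n. (\<alpha> n)\<^sup>2) \<longlonglongrightarrow> l"
    and v_pos: "\<And>k. v_seq \<alpha> k > 0"
  defines "M \<equiv> ((S\<^sup>2 - P) / P)\<^sup>2"
  shows "tridiag_tail (u_br \<alpha> j) (v_br \<alpha> j) (w_br \<alpha> j) (m div 2 + 1)
    (M * (S\<^sup>2 - 2 * P)) (M\<^sup>2 * P\<^sup>2) (M * l\<^sup>2)"
proof -
  define a where "a n = (\<alpha> n)\<^sup>2" for n
  define i where "i = (if j = 1 then 0 else 1 :: nat)"
  define N where "N = m div 2 + 1"
  have br: "branch f j n = f (2 * n + i)" for f n
    by (simp add: branch_def i_def)
  have M: "M > 0" using SP P by (simp add: M_def)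
  note tail = linear_recurrence_quotients[of "\<lambda>n. (\<alpha> (m + n))\<^sup>2" S P]
  have tail_w: "w_seq \<alpha> (Suc k) = u_seq \<alpha> (Suc k) * v_seq \<alpha> (k + 3)" if "k \<ge> m" for k
    using tail(1)[of "k - m"] that pos rec by (simp add: seq_eqs)
  have u_pos: "u_seq \<alpha> (Suc k) > 0" if "k \<ge> m" for k
    using strict[OF that] by (simp add: seq_eqs)
  have tail_eta: "v_seq \<alpha> (k + 3) / u_seq \<alpha> (k + 3) = M * (a k * a (k + 1))" if "k \<ge> m" for k
  proof -
    have u3: "u_seq \<alpha> (k + 3) = a (k + 3) - a (k + 2)"
      using seq_eqs(2)[of \<alpha> "k + 2"] by (simp add: a_def eval_nat_numeral)
    have "u_seq \<alpha> (k + 3) > 0"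
      using u_pos[of "k + 2"] that by (simp add: eval_nat_numeral)
    moreover have "P\<^sup>2 * v_seq \<alpha> (k + 3) = (S\<^sup>2 - P)\<^sup>2 * (a k * a (k + 1)) * u_seq \<alpha> (k + 3)"
      using tail(2)[of "k - m"] that pos rec by (simp add: seq_eqs u3 a_def)
    ultimately show ?thesis
      using P by (simp add: M_def field_simps)
  qed
  have tail_a: "a k * a (k + 1) * (a (k + 2) * a (k + 3)) = (S\<^sup>2 - 2 * P) * (a k * a (k + 1)) - P\<^sup>2"
    if "k \<ge> m" for k
    using tail(3)[of "k - m"] that pos rec by (simp add: a_def)
  have idx1: "\<exists>k\<ge>m. 2 * n + i = Suc k" if "n \<ge> N" for n
    using that by (intro exI[of _ "2 * n + i - 1"]) (auto simp: N_def)
  have idx3: "\<exists>k\<ge>m. 2 * n + i = k + 3" if "n > N" for n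
    using that by (intro exI[of _ "2 * n + i - 3"]) (auto simp: N_def)
  have "tridiag_tail (u_br \<alpha> j) (v_br \<alpha> j) (w_br \<alpha> j) N
    (M * (S\<^sup>2 - 2 * P)) (M\<^sup>2 * P\<^sup>2) (M * l\<^sup>2)"
  proof
    show "N > 0" by (simp add: N_def)
    show "v_br \<alpha> j n > 0" for n
      by (simp add: br v_pos)
    show "u_br \<alpha> j n \<ge> 0" for n
      using pos mono unfolding br by (cases "2 * n + i") (simp_all add: seq_eqs)
    show "u_br \<alpha> j n > 0" if "n > N" for n
      using idx1[of n] that u_pos unfolding br by force
    show "w_br \<alpha> j n = u_br \<alpha> j n * v_br \<alpha> j (Suc n)" if "n \<ge> N" for n
    proof -
      obtain k where k: "k \<ge> m" "2 * n + i = Suc k"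
        using idx1[OF \<open>n \<ge> N\<close>] by blast
      then have k': "2 * Suc n + i = k + 3" by simp
      show ?thesis
        unfolding br k(2) k' by (rule tail_w[OF k(1)])
    qed
    \<comment> \<open>One step within a branch moves two places in the full sequence, so consecutive
      ratios belong to adjacent disjoint pairs of weights, as in \<open>tail_a\<close>.\<close>
    have eta: "\<exists>k\<ge>m. v_br \<alpha> j n / u_br \<alpha> j n = M * (a k * a (k + 1)) \<and>
        v_br \<alpha> j (Suc n) / u_br \<alpha> j (Suc n) = M * (a (k + 2) * a (k + 3))" if "n > N" for n
    proof -
      obtain k where k: "k \<ge> m" "2 * n + i = k + 3"
        using idx3[OF \<open>n > N\<close>] by blast
      then have "2 * Suc n + i = (k + 2) + 3" by simp
      with k tail_eta[of k] tail_eta[of "k + 2"] show ?thesis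
        unfolding br by (intro exI[of _ k]) (simp add: eval_nat_numeral)
    qed
    show "v_br \<alpha> j (Suc n) / u_br \<alpha> j (Suc n) * (v_br \<alpha> j n / u_br \<alpha> j n) =
        M * (S\<^sup>2 - 2 * P) * (v_br \<alpha> j n / u_br \<alpha> j n) - M\<^sup>2 * P\<^sup>2" if "n > N" for n
    proof -
      obtain k where k: "k \<ge> m" "v_br \<alpha> j n / u_br \<alpha> j n = M * (a k * a (k + 1))"
        "v_br \<alpha> j (Suc n) / u_br \<alpha> j (Suc n) = M * (a (k + 2) * a (k + 3))"
        using eta[OF \<open>n > N\<close>] by blast
      have "M * (a (k + 2) * a (k + 3)) * (M * (a k * a (k + 1))) =
          M\<^sup>2 * (a k * a (k + 1) * (a (k + 2) * a (k + 3)))"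
        by (simp add: power2_eq_square)
      also have "\<dots> = M * (S\<^sup>2 - 2 * P) * (M * (a k * a (k + 1))) - M\<^sup>2 * P\<^sup>2"
        unfolding tail_a[OF k(1)] by (simp add: power2_eq_square algebra_simps)
      finally show ?thesis unfolding k .
    qed
    show "v_br \<alpha> j n / u_br \<alpha> j n < v_br \<alpha> j (Suc n) / u_br \<alpha> j (Suc n)" if "n > N" for n
    proof -
      obtain k where k: "k \<ge> m" "v_br \<alpha> j n / u_br \<alpha> j n = M * (a k * a (k + 1))"
        "v_br \<alpha> j (Suc n) / u_br \<alpha> j (Suc n) = M * (a (k + 2) * a (k + 3))"
        using eta[OF \<open>n > N\<close>] by blast
      have "a k < a (k + 1)" "a (k + 1) < a (k + 2)" "a (k + 2) < a (k + 3)"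
        using strict[of k] strict[of "k + 1"] strict[of "k + 2"] k(1)
        by (simp_all add: a_def eval_nat_numeral)
      then have "a k * a (k + 1) < a (k + 2) * a (k + 3)"
        using pos[of k] pos[of "k + 1"] by (intro mult_strict_mono) (auto simp: a_def)
      then show ?thesis
        unfolding k using M by (intro mult_strict_left_mono)
    qed
    have a_lim: "(\<lambda>n. a (2 * n + c)) \<longlonglongrightarrow> l" for c
      using lim unfolding a_def[symmetric]
      by (rule filterlim_compose) (intro filterlim_subseq strict_monoI, simp)
    \<comment> \<open>The position three places before the branch entry n = N + 1, that is 2 * (N +
      1) + i - 3.\<close>
    define e where "e = 2 * N + i - 1"
    have e: "2 * N + i = e + 1" "m \<le> e"
      by (auto simp: e_def N_def)
    have "(\<lambda>n. M * (a (2 * n + e) * a (2 * n + (e + 1)))) \<longlonglongrightarrow> M * (l * l)"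
      by (intro tendsto_mult tendsto_const a_lim)
    moreover have "v_br \<alpha> j (n + (N + 1)) / u_br \<alpha> j (n + (N + 1)) =
        M * (a (2 * n + e) * a (2 * n + (e + 1)))" for n
    proof -
      have "2 * (n + (N + 1)) + i = 2 * n + e + 3"
        using e(1) by simp
      moreover have "m \<le> 2 * n + e"
        using e(2) by simp
      ultimately show ?thesis
        using tail_eta[of "2 * n + e"] unfolding br by (simp only: add.assoc)
    qed
    ultimately have "(\<lambda>n. v_br \<alpha> j (n + (N + 1)) / u_br \<alpha> j (n + (N + 1))) \<longlonglongrightarrow> M * l\<^sup>2"
      by (simp only: power2_eq_square)
    then show "(\<lambda>n. v_br \<alpha> j n / u_br \<alpha> j n) \<longlonglongrightarrow> M * l\<^sup>2"
      by (rule LIMSEQ_offset)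
  qed
  then show ?thesis by (simp add: N_def)
qed

lemma (in tridiag_tail) tridiag_coeff_lead_pos: "c n (n + 1) > 0"
  by (simp add: tridiag_coeff_lead prod_pos V_pos)

lemma pos_det_coeffs_iff:
  assumes "tridiag_tail (u_br \<alpha> j) (v_br \<alpha> j) (w_br \<alpha> j) N A B K"
  shows "pos_det_coeffs \<alpha> j \<longleftrightarrow>
    (\<forall>i\<le>N - 1.
       ((\<Sum>k=0..i. Q_coeff \<alpha> N j k * c_hat \<alpha> j N (N - k)) \<ge> 0 \<and>
        c_coeff \<alpha> j (N + 1 + i) (N + 1) \<ge> 0) \<or>
       ((\<Sum>k=0..i. Q_coeff \<alpha> N j k * c_hat \<alpha> j N (N - k)) \<le> 0 \<and>
        (\<Prod>k=0..N. v_br \<alpha> j k) + (\<Sum>k=0..i. K ^ (k + 1) * c_hat \<alpha> j N (N - k)) \<ge> 0)) \<and>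
    (\<forall>n\<in>{1..N}. \<forall>i\<in>{1..n}. c_coeff \<alpha> j n i \<ge> 0) \<and>
    (\<forall>n\<in>{N + 1..2 * N - 1}. \<forall>i\<in>{n + 1 - N..N}. c_coeff \<alpha> j n i \<ge> 0)"
proof -
  interpret tridiag_tail "u_br \<alpha> j" "v_br \<alpha> j" "w_br \<alpha> j" N A B K
    by (rule assms)
  have hat: "c_hat \<alpha> j n i = ch n i" for n i
    by (simp add: c_hat_def ch_def c_coeff_eq)
  have eta: "eta_br \<alpha> j n = \<eta> n" for n
    by (simp add: eta_br_def \<eta>_def branch_def)
  have shift: "(\<Prod>r=1..k+1. f r) = (\<Prod>r\<le>k. f (Suc r))" for f :: "nat \<Rightarrow> real" and k
    using prod.shift_bounds_cl_Suc_ivl[of f 0 k] unfolding atLeast0AtMost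
    by (simp del: prod.cl_ivl_Suc)
  have Q: "Q_coeff \<alpha> N j k = Q k" for k
    unfolding Q_coeff_def Q_quot_def Q_def \<eta>_prod_def eta shift atLeast0AtMost by simp
  show ?thesis
    using coeffs_nonneg_iff tridiag_coeff_lead_pos
    unfolding pos_det_coeffs_def hat Q c_coeff_eq F_slope_def F_lim_def atLeast0AtMost by simp
qed

lemma backward_extension_sq:
  fixes x :: "nat \<Rightarrow> real"
  assumes xm: "0 < x m" and x_mono: "\<And>i. 1 \<le> i \<Longrightarrow> i < m \<Longrightarrow> x (i + 1) \<le> x i"
    and x1: "x 1 \<le> u" and u: "0 < u" "u < v" "v < w"
  defines "a \<equiv> \<lambda>n. (backward_extension m x u v w n)\<^sup>2"
  shows "a (m + n) = (stampfli u v w n)\<^sup>2"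
    and "a n > 0" and "a n \<le> a (Suc n)"
proof -
  \<comment> \<open>The x's decrease with their index, so positivity spreads from x m to the smaller
    indices.\<close>
  have x_pos: "x i > 0" if "1 \<le> i" "i \<le> m" for i
    using that(2,1) by (induction rule: inc_induct) (use xm x_mono in force)+
  have low: "a n = x (m - n)" if "n < m" for n
  proof -
    have "x (m - n) > 0"
      using that by (intro x_pos) auto
    with that show ?thesis
      by (simp add: a_def backward_extension_def)
  qed
  show high: "a (m + n) = (stampfli u v w n)\<^sup>2" for n
    by (simp add: a_def backward_extension_def)
  have high': "a n = (stampfli u v w (n - m))\<^sup>2" if "n \<ge> m" for n
    using high[of "n - m"] that by simp
  show "a n > 0"
  proof (cases "n < m")
    case True
    then show ?thesis
      unfolding low[OF True] by (intro x_pos) auto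
  next
    case False
    then show ?thesis
      using stampfli_sq(2)[OF u, of "n - m"] by (simp add: high')
  qed
  consider "Suc n < m" | "Suc n = m" | "n \<ge> m" by linarith
  then show "a n \<le> a (Suc n)"
  proof cases
    case 1
    then show ?thesis
      using x_mono[of "m - Suc n"] by (simp add: low Suc_diff_Suc)
  next
    \<comment> \<open>The junction, where x 1 meets the first Stampfli value u.\<close>
    case 2
    then have "m - n = 1" by simp
    then show ?thesis
      using 2 x1 stampfli_sq(1)[OF u] by (simp add: low high' del: stampfli.simps)
  next
    case 3
    then show ?thesis
      using stampfli_sq(3)[OF u, of "n - m"] by (simp add: high' Suc_diff_le)
  qed
qed

theorem theorem4p11:
  fixes m m0 :: nat and x :: "nat \<Rightarrow> real" and u v w K :: real and \<alpha> :: "nat \<Rightarrow> real"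
  assumes "m \<ge> 1"
    and "0 < x m" and "\<And>i. 1 \<le> i \<Longrightarrow> i < m \<Longrightarrow> x (i + 1) \<le> x i" and "x 1 \<le> u"
    and "u < v" and "v < w"
    and "\<alpha> = backward_extension m x u v w"
    and "m0 = m div 2 + 1"
    and "K = stampfli_K u v w"
    and "\<And>k. v_seq \<alpha> k > 0"
  shows "semi_cubically_hyponormal_pdc \<alpha> \<longleftrightarrow>
    (\<forall>j\<in>{1, 2}.
      (\<forall>i\<le>m0 - 1.
         ((\<Sum>k=0..i. Q_coeff \<alpha> m0 j k * c_hat \<alpha> j m0 (m0 - k)) \<ge> 0 \<and>
          c_coeff \<alpha> j (m0 + 1 + i) (m0 + 1) \<ge> 0) \<or>
         ((\<Sum>k=0..i. Q_coeff \<alpha> m0 j k * c_hat \<alpha> j m0 (m0 - k)) \<le> 0 \<and>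
          (\<Prod>k=0..m0. v_br \<alpha> j k) + (\<Sum>k=0..i. K ^ (k + 1) * c_hat \<alpha> j m0 (m0 - k)) \<ge> 0)) \<and>
      (\<forall>n\<in>{1..m0}. \<forall>i\<in>{1..n}. c_coeff \<alpha> j n i \<ge> 0) \<and>
      (\<forall>n\<in>{m0 + 1..2 * m0 - 1}. \<forall>i\<in>{n + 1 - m0..m0}. c_coeff \<alpha> j n i \<ge> 0))"
proof -
  \<comment> \<open>Positivity of u comes from 0 < x m \<le> x 1 \<le> u.\<close>
  have "x m \<le> x 1"
    using assms(1) by (induction rule: dec_induct) (use assms(3) in force)+
  then have u: "0 < u" "u < v" "v < w"
    using assms by auto
  define S where "S = Psi1 u v w"
  define P where "P = - Psi0 u v w"
  define l where "l = (stampfli_L u v w)\<^sup>2"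
  note a = backward_extension_sq[OF assms(2-4) u, folded assms(7)]
  have pos: "(\<alpha> n)\<^sup>2 > 0" and mono: "(\<alpha> n)\<^sup>2 \<le> (\<alpha> (Suc n))\<^sup>2" for n
    using a by blast+
  have tail: "(\<alpha> n)\<^sup>2 = (stampfli u v w (n - m))\<^sup>2" if "n \<ge> m" for n
    using a(1)[of "n - m"] that by simp
  have strict: "(\<alpha> n)\<^sup>2 < (\<alpha> (Suc n))\<^sup>2"
    and rec: "(\<alpha> (Suc n))\<^sup>2 * (\<alpha> n)\<^sup>2 = S * (\<alpha> n)\<^sup>2 - P" if "n \<ge> m" for n
    using that stampfli_sq(3)[OF u, of "n - m"] stampfli_sq_mult[OF u, of "n - m"]
    by (simp_all add: tail Suc_diff_le S_def P_def)
  have "(\<lambda>n. (\<alpha> (n + m))\<^sup>2) \<longlonglongrightarrow> l"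
    using stampfli_sq_tendsto[OF u] unfolding l_def by (simp add: a(1) add.commute[of _ m])
  then have lim: "(\<lambda>n. (\<alpha> n)\<^sup>2) \<longlonglongrightarrow> l"
    by (rule LIMSEQ_offset)
  have P: "P > 0"
    using Psi0_neg[OF u] by (simp add: P_def)
  have Pu: "P = u * (S - v)"
    using Psi_u[OF u] u by (simp add: S_def P_def field_simps)
  then have "S > v"
    using P u by (simp add: zero_less_mult_iff)
  \<comment> \<open>Here u < v < S. The resulting S^2 > P keeps the factor between ratios and weight
    products from vanishing.\<close>
  then have "u * (S - v) < S * S"
    using u by (intro mult_strict_mono) auto
  then have SP: "S\<^sup>2 \<noteq> P"
    by (simp add: Pu power2_eq_square)
  have K: "((S\<^sup>2 - P) / P)\<^sup>2 * l\<^sup>2 = K"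
    unfolding assms(9) stampfli_K_def l_def S_def P_def by (simp add: power_divide)
  have tails: "tridiag_tail (u_br \<alpha> j) (v_br \<alpha> j) (w_br \<alpha> j) m0 (((S\<^sup>2 - P) / P)\<^sup>2 * (S\<^sup>2 - 2 * P))
      ((((S\<^sup>2 - P) / P)\<^sup>2)\<^sup>2 * P\<^sup>2) K" for j
    unfolding K[symmetric] assms(8)
    by (rule tridiag_tail_branch[OF pos mono strict rec P SP lim assms(10)])
  have "semi_cubically_hyponormal_pdc \<alpha> \<longleftrightarrow> (\<forall>j\<in>{1, 2}. pos_det_coeffs \<alpha> j)"
  proof
    assume *: "\<forall>j\<in>{1, 2}. pos_det_coeffs \<alpha> j"
    have "incseq (\<lambda>n. (\<alpha> n)\<^sup>2)"
      using mono by (rule incseq_SucI)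
    then have "\<bar>\<alpha> n\<bar> \<le> sqrt l" for n
      using incseq_le[OF _ lim, of n] by (intro real_le_rsqrt) simp
    moreover have "u_seq \<alpha> k \<ge> 0" for k
      using mono by (cases k) (simp_all add: seq_eqs)
    ultimately have "semi_cubically_hyponormal (weighted_shift \<alpha>)"
      using * by (intro semi_cubically_hyponormal_of_pos_det_coeffs) blast+
    with * show "semi_cubically_hyponormal_pdc \<alpha>"
      by (simp add: semi_cubically_hyponormal_pdc_def)
  qed (auto simp: semi_cubically_hyponormal_pdc_def)
  then show ?thesis
    unfolding pos_det_coeffs_iff[OF tails] .
qed

end
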